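(* Let $d\geq\gamma\geq 0$ and let $P$ be a $d$-polytope with $d+\gamma+1$ vertices. Then the following are equivalent: (i) every facet $F$ of $P$ satisfies $|V(P)\setminus V(F)|\leq 2$; (ii) $P$ is combinatorially equivalent to $P(n,j_1,k_1,\dots,j_m,k_m)=\Delta_{n-1}*(\Delta_{j_1}\oplus\Delta_{k_1})*\cdots*(\Delta_{j_m}\oplus\Delta_{k_m})$ for some integers $n,m\geq 0$ and $j_1,k_1,\dots,j_m,k_m\geq 1$; (iii) $P$ has no face of dimension $d-\gamma+1$ that is a simplex.
   Context: $V(Q)$ denotes the vertex set of a polytope $Q$. $\Delta_j$ is the $j$-dimensional simplex ($\Delta_{-1}$ is the empty polytope, the identity for the join). $P*Q$ denotes the join of polytopes (convex hull of copies of $P$ and $Q$ in skew affine subspaces; dimension $\dim P+\dim Q+1$). $P\oplus Q$ denotes the (direct) sum of polytopes (convex hull of copies of $P$ and $Q$ placed in complementary linear subspaces with the origin in the relative interior of each; dimension $\dim P+\dim Q$). *)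

theory Defs
  imports "HOL-Analysis.Analysis"
begin

definition vertices :: "'a::euclidean_space set \<Rightarrow> 'a set" where
  "vertices P = {v. v extreme_point_of P}"

text \<open>The face lattice includes the improper faces \<open>{}\<close> and \<open>P\<close>.\<close>

definition combinatorially_equivalent ::
    "'a::euclidean_space set \<Rightarrow> 'b::euclidean_space set \<Rightarrow> bool" where
  "combinatorially_equivalent P Q \<longleftrightarrow>
     (\<exists>\<phi>. bij_betw \<phi> {F. F face_of P} {G. G face_of Q} \<and>
          (\<forall>F F'. F face_of P \<longrightarrow> F' face_of P \<longrightarrow> (F \<subseteq> F' \<longleftrightarrow> \<phi> F \<subseteq> \<phi> F')))"

definition affine_copy :: "'a::euclidean_space set \<Rightarrow> 'b::euclidean_space set \<Rightarrow> bool" where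
  "affine_copy P P' \<longleftrightarrow>
     (\<exists>f c. linear f \<and> inj_on (\<lambda>x. c + f x) (affine hull P) \<and> P' = (\<lambda>x. c + f x) ` P)"

text \<open>Two affine subspaces are skew if they are disjoint and have no common direction.\<close>

definition skew :: "'a::euclidean_space set \<Rightarrow> 'a set \<Rightarrow> bool" where
  "skew A B \<longleftrightarrow>
     A \<inter> B = {} \<and> (\<forall>a\<in>A. \<forall>a'\<in>A. \<forall>b\<in>B. \<forall>b'\<in>B. a - a' = b - b' \<longrightarrow> a = a')"

text \<open>Joins and direct sums are determined only up to the choice of the copies, so they are
  relations: \<open>R\<close> is a join (a direct sum) of \<open>P\<close> and \<open>Q\<close>. Each of the three polytopes may have
  smaller dimension than the space it lives in; in particular, for a direct sum the two linear
  spans are complementary in the linear span of \<open>R\<close>.\<close>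

definition is_join ::
    "'a::euclidean_space set \<Rightarrow> 'b::euclidean_space set \<Rightarrow> 'c::euclidean_space set \<Rightarrow> bool" where
  "is_join P Q R \<longleftrightarrow>
     (\<exists>P' Q'. affine_copy P P' \<and> affine_copy Q Q' \<and>
        skew (affine hull P') (affine hull Q') \<and> R = convex hull (P' \<union> Q'))"

definition is_direct_sum ::
    "'a::euclidean_space set \<Rightarrow> 'b::euclidean_space set \<Rightarrow> 'c::euclidean_space set \<Rightarrow> bool" where
  "is_direct_sum P Q R \<longleftrightarrow>
     (\<exists>P' Q'. affine_copy P P' \<and> affine_copy Q Q' \<and>
        span P' \<inter> span Q' = {0} \<and> 0 \<in> rel_interior P' \<and> 0 \<in> rel_interior Q' \<and>
        R = convex hull (P' \<union> Q'))"

text \<open>\<open>simplex_sum_join n [(j\<^sub>1,k\<^sub>1),\<dots>,(j\<^sub>m,k\<^sub>m)] R\<close> says that \<open>R\<close> is a realization of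
  \<open>\<Delta>\<^bsub>n-1\<^esub> * (\<Delta>\<^bsub>j1\<^esub> \<oplus> \<Delta>\<^bsub>k1\<^esub>) * \<dots> * (\<Delta>\<^bsub>jm\<^esub> \<oplus> \<Delta>\<^bsub>km\<^esub>)\<close>, bracketed to the left.
  Since \<open>(-1) simplex S\<close> means \<open>S = {}\<close>, \<open>n = 0\<close> gives the empty polytope.
  A realization exists in every space of dimension at least
  \<open>n - 1 + (\<Sum>i. j\<^sub>i + k\<^sub>i + 1)\<close>, the dimension of the polytope.\<close>

inductive simplex_sum_join ::
    "nat \<Rightarrow> (nat \<times> nat) list \<Rightarrow> 'a::euclidean_space set \<Rightarrow> bool" where
  simplex: "(int n - 1) simplex S \<Longrightarrow> simplex_sum_join n [] S"
| join: "\<lbrakk>simplex_sum_join n jks Q; int j simplex (A :: 'a set); int k simplex (B :: 'a set);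
          is_direct_sum A B (S :: 'a set); is_join Q S R\<rbrakk> \<Longrightarrow> simplex_sum_join n (jks @ [(j, k)]) R"

end

theory Submission
  imports Defs
begin

text \<open>A face of a polytope is the zero set of a nonnegative affine functional, and only the values
  of the functional at the vertices matter: by duality, these are the functions annihilated by all
  affine relations of the vertices. If every facet misses at most two vertices, the facets missing
  exactly two are the edges of a graph on the vertices, and a vertex that is alone in being missed
  by a facet is an apex of a pyramid. A path of three edges closes up, by an alternating sum of the three functionals,
  so the components of the graph are complete bipartite. Every functional is a combination of those
  of the facets; hence affine relations split along the components, the polytope is itself a join
  over the components, and each component carries a single affine relation, positive on one side and
  negative on the other, which makes it a direct sum of two simplices.

  In a join of direct sums of simplices the support of every nonnegative functional contains that
  of a nonnegative functional nonzero at one vertex or two. This bounds the facets, which are the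
  coatoms of the face lattice, so the bound passes to combinatorially equivalent polytopes.

  A face that is a simplex omits a vertex on each side of each component, which bounds its
  dimension. Conversely, a facet with at least three missing vertices has so few vertices that
  induction over facets produces a large simplex in it.\<close>

subsection \<open>Affine relations and the values of affine functionals\<close>

definition affine_relation :: "'a::real_vector set \<Rightarrow> ('a \<Rightarrow> real) \<Rightarrow> bool" where
  "affine_relation V l \<longleftrightarrow> sum l V = 0 \<and> (\<Sum>v\<in>V. l v *\<^sub>R v) = 0"

text \<open>For finite \<open>V\<close> these are the restrictions to \<open>V\<close> of the
  functions \<open>w \<bullet> x + c\<close>, by \<open>affine_values_iff\<close>. In the dual form,
  restricting a functional or extending it by zero becomes a statement about relations.\<close>

definition affine_values :: "'a::real_vector set \<Rightarrow> ('a \<Rightarrow> real) \<Rightarrow> bool" where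
  "affine_values V g \<longleftrightarrow> (\<forall>l. affine_relation V l \<longrightarrow> (\<Sum>v\<in>V. l v * g v) = 0)"

text \<open>For a nonnegative functional this is the set of points of \<open>V\<close> off the face
  that it exposes.\<close>

definition supp :: "'a set \<Rightarrow> ('a \<Rightarrow> real) \<Rightarrow> 'a set" where
  "supp V g = {v\<in>V. g v \<noteq> 0}"

lemma sum_of_bool_scaleR:
  "finite V \<Longrightarrow> v \<in> V \<Longrightarrow> (\<Sum>u\<in>V. of_bool (u = v) *\<^sub>R u) = (v :: 'a::real_vector)"
  by (simp add: of_bool_def if_distrib[of "\<lambda>c. c *\<^sub>R _"] cong: if_cong)

lemma affine_valuesD:
  "affine_values V g \<Longrightarrow> affine_relation V l \<Longrightarrow> (\<Sum>v\<in>V. l v * g v) = 0"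
  by (simp add: affine_values_def)

lemma affine_values_cong:
  assumes "\<And>v. v \<in> V \<Longrightarrow> g v = h v"
  shows "affine_values V g \<longleftrightarrow> affine_values V h"
  using assms by (simp add: affine_values_def cong: sum.cong)

lemma affine_values_add:
  "affine_values V g \<Longrightarrow> affine_values V h \<Longrightarrow> affine_values V (\<lambda>v. g v + h v)"
  by (simp add: affine_values_def distrib_left sum.distrib)

lemma affine_values_scale: "affine_values V g \<Longrightarrow> affine_values V (\<lambda>v. c * g v)"
  by (simp add: affine_values_def mult.left_commute[of _ c] flip: sum_distrib_left)

lemma affine_values_diff:
  "affine_values V g \<Longrightarrow> affine_values V h \<Longrightarrow> affine_values V (\<lambda>v. g v - h v)"
  by (simp add: affine_values_def right_diff_distrib sum_subtractf)

lemma affine_values_inner: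
  fixes V :: "'a::real_inner set"
  shows "affine_values V (\<lambda>v. w \<bullet> v + c)"
proof -
  have "(\<Sum>v\<in>V. l v * (w \<bullet> v + c)) = w \<bullet> (\<Sum>v\<in>V. l v *\<^sub>R v) + c * sum l V" for l
    by (simp add: inner_sum_right distrib_left sum.distrib sum_distrib_left mult.commute)
  then show ?thesis
    by (simp add: affine_values_def affine_relation_def)
qed

lemma affine_values_const: "affine_values (V :: 'a::real_inner set) (\<lambda>v. c)"
  using affine_values_inner[of V 0 c] by simp

lemma affine_relation_extend:
  assumes "finite V" "C \<subseteq> V" "affine_relation C l"
  shows "affine_relation V (\<lambda>v. if v \<in> C then l v else 0)"
proof -
  have eq: "V \<inter> C = C" using assms by auto
  have "(\<Sum>v\<in>V. (if v \<in> C then l v else 0) *\<^sub>R v) = (\<Sum>v\<in>V. if v \<in> C then l v *\<^sub>R v else 0)"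
    by (intro sum.cong) auto
  then show ?thesis
    using assms by (auto simp: affine_relation_def eq simp flip: sum.inter_restrict)
qed

lemma affine_values_subset:
  assumes "finite V" "C \<subseteq> V" "affine_values V g"
  shows "affine_values C g"
  unfolding affine_values_def
proof (intro allI impI)
  fix l assume "affine_relation C l"
  then have "(\<Sum>v\<in>V. (if v \<in> C then l v else 0) * g v) = 0"
    using affine_relation_extend affine_valuesD assms by metis
  moreover have "(\<Sum>v\<in>V. (if v \<in> C then l v else 0) * g v) = (\<Sum>v\<in>V. if v \<in> C then l v * g v else 0)"
    by (intro sum.cong) auto
  moreover have "V \<inter> C = C" using assms by auto
  ultimately show "(\<Sum>v\<in>C. l v * g v) = 0"
    using assms(1) by (simp flip: sum.inter_restrict)
qed

lemma affine_dependent_iff_relation: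
  assumes "finite V"
  shows "affine_dependent V \<longleftrightarrow> (\<exists>l. affine_relation V l \<and> (\<exists>v\<in>V. l v \<noteq> 0))"
  using affine_dependent_explicit_finite[OF assms] by (auto simp: affine_relation_def)

lemma affine_independent_affine_values:
  fixes V :: "'a::euclidean_space set"
  assumes "\<not> affine_dependent V"
  shows "affine_values V g"
proof -
  have "finite V" by (rule aff_independent_finite[OF assms])
  then have "\<forall>v\<in>V. l v = 0" if "affine_relation V l" for l
    using assms that affine_dependent_iff_relation by blast
  then show ?thesis
    unfolding affine_values_def by (auto intro!: sum.neutral)
qed

text \<open>Values on an affine basis \<open>B\<close> of \<open>V\<close> can be prescribed freely
  by extending a linear map. The value at any other point is then forced, by the relation that
  writes the point as an affine combination of \<open>B\<close>.\<close>

lemma affine_values_iff: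
  fixes V :: "'a::euclidean_space set"
  assumes fin: "finite V"
  shows "affine_values V g \<longleftrightarrow> (\<exists>w c. \<forall>v\<in>V. g v = w \<bullet> v + c)"
proof
  assume "\<exists>w c. \<forall>v\<in>V. g v = w \<bullet> v + c"
  then show "affine_values V g"
    using affine_values_inner affine_values_cong by metis
next
  assume g: "affine_values V g"
  obtain B where B: "B \<subseteq> V" "\<not> affine_dependent B" "affine hull V = affine hull B"
    using affine_basis_exists by blast
  have finB: "finite B" using B fin finite_subset by blast
  show "\<exists>w c. \<forall>v\<in>V. g v = w \<bullet> v + c"
  proof (cases "B = {}")
    case True
    then have "V = {}" using B by (metis affine_hull_eq_empty)
    then show ?thesis by simp
  next
    case False
    then obtain b where b: "b \<in> B" by blast
    have "independent ((\<lambda>x. -b + x) ` (B - {b}))"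
      using affine_dependent_iff_dependent2[OF b] B by blast
    then obtain f where f: "linear f" "\<And>x. x \<in> (\<lambda>x. -b + x) ` (B - {b}) \<Longrightarrow> f x = g (b + x) - g b"
      using linear_independent_extend[of _ "\<lambda>x. g (b + x) - g b"] by metis
    \<comment> \<open>\<open>f\<close> is real-valued, so \<open>adjoint f 1\<close> is the vector
      that represents it by an inner product.\<close>
    define w where "w = adjoint f 1"
    have fw: "f x = w \<bullet> x" for x
      using adjoint_works[OF f(1), of x 1] by (simp add: w_def inner_commute)
    have gB: "g x = w \<bullet> x + (g b - w \<bullet> b)" if "x \<in> B" for x
    proof (cases "x = b")
      case False
      then have "f (-b + x) = g (b + (-b + x)) - g b"
        using that by (intro f(2)) auto
      then show ?thesis by (simp add: fw inner_diff_right)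
    qed auto
    have "g v = w \<bullet> v + (g b - w \<bullet> b)" if v: "v \<in> V" for v
    proof -
      have "v \<in> affine hull B" using v B(3) hull_inc by metis
      then obtain u where u: "sum u B = 1" "(\<Sum>x\<in>B. u x *\<^sub>R x) = v"
        using affine_hull_finite[OF finB] by auto
      have VB: "V \<inter> B = B" using B by auto
      \<comment> \<open>The relation between \<open>v\<close> and its affine coordinates over
        \<open>B\<close>.\<close>
      define l where "l x = (if x \<in> B then u x else 0) - of_bool (x = v)" for x
      have *: "(\<Sum>x\<in>V. l x * h x) = (\<Sum>x\<in>B. u x * h x) - h v" for h :: "'a \<Rightarrow> real"
      proof -
        have "(\<Sum>x\<in>V. l x * h x) = (\<Sum>x\<in>V. (if x \<in> B then u x * h x else 0) - (if x = v then h x else 0))"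
          by (intro sum.cong) (auto simp: l_def left_diff_distrib)
        then show ?thesis
          using fin v by (simp add: sum_subtractf VB flip: sum.inter_restrict)
      qed
      have **: "(\<Sum>x\<in>V. l x *\<^sub>R x) = (\<Sum>x\<in>B. u x *\<^sub>R x) - v"
      proof -
        have "(\<Sum>x\<in>V. l x *\<^sub>R x) = (\<Sum>x\<in>V. (if x \<in> B then u x *\<^sub>R x else 0) - (if x = v then x else 0))"
          by (intro sum.cong) (auto simp: l_def scaleR_left_diff_distrib)
        then show ?thesis
          using fin v by (simp add: sum_subtractf VB flip: sum.inter_restrict)
      qed
      have "affine_relation V l"
        using *[of "\<lambda>_. 1"] ** u by (simp add: affine_relation_def)
      from affine_valuesD[OF g this] have "g v = (\<Sum>x\<in>B. u x * g x)"
        by (simp add: *)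
      also have "\<dots> = (\<Sum>x\<in>B. u x * (w \<bullet> x + (g b - w \<bullet> b)))"
        using gB by (intro sum.cong) auto
      also have "\<dots> = w \<bullet> (\<Sum>x\<in>B. u x *\<^sub>R x) + sum u B * (g b - w \<bullet> b)"
        by (simp add: inner_sum_right distrib_left sum.distrib sum_distrib_right)
      finally show ?thesis using u by simp
    qed
    then show ?thesis by blast
  qed
qed

text \<open>This turns a direction into a point of the hull: both \<open>skew\<close> and
  injectivity on \<open>affine hull\<close> speak of points only.\<close>

lemma add_mem_affine_hull:
  assumes "finite V" "v \<in> V" "sum l V = 0"
  shows "v + (\<Sum>u\<in>V. l u *\<^sub>R u) \<in> affine hull V"
  unfolding affine_hull_finite[OF assms(1)] mem_Collect_eq
  using assms
  by (intro exI[of _ "\<lambda>u. of_bool (u = v) + l u"])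
    (simp add: sum.distrib scaleR_left_distrib sum_of_bool_scaleR)

text \<open>Skewness means that the relations of \<open>V \<union> W\<close> split. In a relation
  that does not split, the part on \<open>V\<close> yields a common point of the hulls if its
  coefficient sum is nonzero, and a common direction otherwise.\<close>

lemma skew_affine_hull_iff:
  fixes V W :: "'a::euclidean_space set"
  assumes fin: "finite V" "finite W"
  shows "skew (affine hull V) (affine hull W) \<longleftrightarrow>
    V \<inter> W = {} \<and> (\<forall>l. affine_relation (V \<union> W) l \<longrightarrow> affine_relation V l)"
proof (intro iffI conjI allI impI)
  assume sk: "skew (affine hull V) (affine hull W)"
  then have disj: "affine hull V \<inter> affine hull W = {}"
    and dir: "\<And>a a' b b'. a \<in> affine hull V \<Longrightarrow> a' \<in> affine hull V \<Longrightarrow>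
        b \<in> affine hull W \<Longrightarrow> b' \<in> affine hull W \<Longrightarrow> a - a' = b - b' \<Longrightarrow> a = a'"
    unfolding skew_def by blast+
  show VW: "V \<inter> W = {}"
    using disj by (metis IntI disjoint_iff hull_inc)
  fix l assume l: "affine_relation (V \<union> W) l"
  define s x where "s = sum l V" and "x = (\<Sum>v\<in>V. l v *\<^sub>R v)"
  have sW: "sum l W = - s" and xW: "(\<Sum>v\<in>W. l v *\<^sub>R v) = - x"
    using l VW fin by (simp_all add: affine_relation_def s_def x_def sum.union_disjoint add_eq_0_iff)
  have s0: "s = 0"
  proof (rule ccontr)
    assume s: "s \<noteq> 0"
    \<comment> \<open>Normalizing the coefficients on \<open>V\<close>, and the negated ones on
      \<open>W\<close>, writes one point as an affine combination of each set.\<close>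
    have "(1/s) *\<^sub>R x \<in> affine hull V"
      unfolding affine_hull_finite[OF fin(1)] mem_Collect_eq
      using s by (intro exI[of _ "\<lambda>v. l v / s"])
        (auto simp: s_def x_def scaleR_sum_right simp flip: sum_divide_distrib)
    moreover have "(1/s) *\<^sub>R x \<in> affine hull W"
      unfolding affine_hull_finite[OF fin(2)] mem_Collect_eq
    proof (intro exI[of _ "\<lambda>v. - l v / s"] conjI)
      show "(\<Sum>v\<in>W. - l v / s) = 1"
        using s sW by (simp add: sum_negf flip: sum_divide_distrib)
      have "(\<Sum>v\<in>W. (- l v / s) *\<^sub>R v) = (-1/s) *\<^sub>R (\<Sum>v\<in>W. l v *\<^sub>R v)"
        by (simp add: scaleR_sum_right)
      then show "(\<Sum>v\<in>W. (- l v / s) *\<^sub>R v) = (1/s) *\<^sub>R x"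
        by (simp add: xW)
    qed
    ultimately show False using disj by blast
  qed
  have "x = 0"
  proof (cases "V = {} \<or> W = {}")
    case True
    then show ?thesis using xW by (auto simp: x_def)
  next
    case False
    then obtain v w where v: "v \<in> V" and w: "w \<in> W" by blast
    have "v + x \<in> affine hull V"
      using add_mem_affine_hull[OF fin(1) v] s0 by (simp add: s_def x_def)
    moreover have "w - x \<in> affine hull W"
      using add_mem_affine_hull[OF fin(2) w, of l] s0 sW xW by simp
    ultimately have "v + x = v"
      using v w by (intro dir[of "v + x" v w "w - x"]) (auto simp: hull_inc)
    then show ?thesis by simp
  qed
  then show "affine_relation V l"
    using s0 by (simp add: affine_relation_def s_def x_def)
next
  assume R: "V \<inter> W = {} \<and> (\<forall>l. affine_relation (V \<union> W) l \<longrightarrow> affine_relation V l)"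
  then have VW: "V \<inter> W = {}" by blast
  \<comment> \<open>The relation is \<open>a\<close> on \<open>V\<close> and \<open>- b\<close> on
    \<open>W\<close>. A common point gives coefficient sums 1, which is absurd; a common direction
    gives sums 0 and must vanish.\<close>
  have glue: "sum a V = 0 \<and> (\<Sum>v\<in>V. a v *\<^sub>R v) = 0"
    if "sum a V = sum b W" "(\<Sum>v\<in>V. a v *\<^sub>R v) = (\<Sum>v\<in>W. b v *\<^sub>R v)" for a b :: "'a \<Rightarrow> real"
  proof -
    define l where "l v = (if v \<in> V then a v else - b v)" for v
    have lV: "sum l V = sum a V" "(\<Sum>v\<in>V. l v *\<^sub>R v) = (\<Sum>v\<in>V. a v *\<^sub>R v)"
      by (simp_all add: l_def cong: sum.cong)
    have "sum l W = (\<Sum>v\<in>W. - b v)" "(\<Sum>v\<in>W. l v *\<^sub>R v) = (\<Sum>v\<in>W. - (b v *\<^sub>R v))"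
      using VW by (auto simp: l_def intro!: sum.cong)
    then have "affine_relation (V \<union> W) l"
      using VW fin that lV by (simp add: affine_relation_def sum.union_disjoint sum_negf)
    then show ?thesis
      using R lV by (simp add: affine_relation_def)
  qed
  show "skew (affine hull V) (affine hull W)"
    unfolding skew_def
  proof (intro conjI ballI impI)
    show "affine hull V \<inter> affine hull W = {}"
    proof (rule ccontr)
      assume "affine hull V \<inter> affine hull W \<noteq> {}"
      then obtain y where "y \<in> affine hull V" "y \<in> affine hull W" by blast
      then obtain a b where "sum a V = 1" "(\<Sum>v\<in>V. a v *\<^sub>R v) = y" "sum b W = 1" "(\<Sum>v\<in>W. b v *\<^sub>R v) = y"
        using fin by (auto simp: affine_hull_finite)
      then show False using glue[of a b] by simp
    qed
  next
    fix a a' b b'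
    assume "a \<in> affine hull V" "a' \<in> affine hull V" "b \<in> affine hull W" "b' \<in> affine hull W"
      and eq: "a - a' = b - b'"
    then obtain p p' q q' where
      "sum p V = 1" "(\<Sum>v\<in>V. p v *\<^sub>R v) = a" "sum p' V = 1" "(\<Sum>v\<in>V. p' v *\<^sub>R v) = a'"
      "sum q W = 1" "(\<Sum>v\<in>W. q v *\<^sub>R v) = b" "sum q' W = 1" "(\<Sum>v\<in>W. q' v *\<^sub>R v) = b'"
      using fin by (auto simp: affine_hull_finite)
    then show "a = a'"
      using glue[of "\<lambda>v. p v - p' v" "\<lambda>v. q v - q' v"] eq
      by (simp add: sum_subtractf scaleR_left_diff_distrib)
  qed
qed

subsection \<open>Polytopes whose facets miss at most two vertices\<close>

text \<open>The facet condition in terms of functionals: \<open>cofacet\<close> says that a vertex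
  \<open>v\<close> off the face \<open>g = 0\<close> is also off a larger or equal face missing at
  most two vertices. By \<open>exposed\<close>, each point of \<open>V\<close> is a vertex.\<close>

locale small_cofacets =
  fixes V :: "'a::euclidean_space set"
  assumes finite_V: "finite V"
    and cofacet: "\<lbrakk>affine_values V g; \<And>x. x \<in> V \<Longrightarrow> 0 \<le> g x; v \<in> V; 0 < g v\<rbrakk> \<Longrightarrow>
      \<exists>h. affine_values V h \<and> (\<forall>x\<in>V. 0 \<le> h x) \<and> 0 < h v \<and>
          supp V h \<subseteq> supp V g \<and> card (supp V h) \<le> 2"
    and exposed: "u \<in> V \<Longrightarrow>
      \<exists>g. affine_values V g \<and> (\<forall>x\<in>V. 0 \<le> g x) \<and> (\<forall>x\<in>V. g x = 0 \<longleftrightarrow> x = u)"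
begin

section \<open>Apices and the graph of functionals supported on two vertices\<close>

definition apices :: "'a set" where
  "apices = {v\<in>V. affine_values V (\<lambda>x. of_bool (x = v))}"

text \<open>Apices are excluded because any positive combination of two apex functionals would
  otherwise count as an edge.\<close>

definition edge :: "'a \<Rightarrow> 'a \<Rightarrow> bool" where
  "edge u v \<longleftrightarrow> u \<in> V - apices \<and> v \<in> V - apices \<and> u \<noteq> v \<and>
     (\<exists>s>0. affine_values V (\<lambda>x. of_bool (x = u) + s * of_bool (x = v)))"

lemma apicesI:
  assumes "v \<in> V" "c \<noteq> 0" "affine_values V (\<lambda>x. c * of_bool (x = v))"
  shows "v \<in> apices"
  using affine_values_scale[OF assms(3), of "1/c"] assms(1,2) by (simp add: apices_def)

lemma edgeD:
  assumes "edge u v"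
  shows "u \<in> V" "v \<in> V" "u \<notin> apices" "v \<notin> apices" "u \<noteq> v"
  using assms by (auto simp: edge_def)

lemma edge_sym:
  assumes "edge u v"
  shows "edge v u"
proof -
  obtain s where s: "s > 0" and av: "affine_values V (\<lambda>x. of_bool (x = u) + s * of_bool (x = v))"
    using assms by (auto simp: edge_def)
  have "affine_values V (\<lambda>x. of_bool (x = v) + (1/s) * of_bool (x = u))"
    using affine_values_scale[OF av, of "1/s"] s by (simp add: field_simps)
  then show ?thesis
    using assms s edgeD[OF assms] unfolding edge_def by (metis Diff_iff zero_less_divide_1_iff)
qed

text \<open>The alternating combination of the three functionals cancels at \<open>v\<close> and
  \<open>w\<close>. If \<open>u\<close> and \<open>x\<close> coincided, it would be a positive
  multiple of the indicator of \<open>u\<close> and make \<open>u\<close> an apex; so the graph has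
  no triangles.\<close>

lemma edge_path3:
  assumes "edge u v" "edge v w" "edge w x"
  shows "edge u x"
proof -
  obtain r where r: "r > 0" "affine_values V (\<lambda>y. of_bool (y = u) + r * of_bool (y = v))"
    using assms by (auto simp: edge_def)
  obtain s where s: "s > 0" "affine_values V (\<lambda>y. of_bool (y = v) + s * of_bool (y = w))"
    using assms by (auto simp: edge_def)
  obtain t where t: "t > 0" "affine_values V (\<lambda>y. of_bool (y = w) + t * of_bool (y = x))"
    using assms by (auto simp: edge_def)
  have "affine_values V (\<lambda>y. (of_bool (y = u) + r * of_bool (y = v)) -
      r * (of_bool (y = v) + s * of_bool (y = w)) + (r * s) * (of_bool (y = w) + t * of_bool (y = x)))"
    by (intro affine_values_add[OF affine_values_diff[OF r(2) affine_values_scale[OF s(2)]]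
          affine_values_scale[OF t(2)]])
  then have av: "affine_values V (\<lambda>y. of_bool (y = u) + (r * s * t) * of_bool (y = x))"
    by (simp add: algebra_simps)
  have pos: "r * s * t > 0" using r s t by simp
  have "u \<noteq> x"
  proof
    assume "u = x"
    with av have "affine_values V (\<lambda>y. (1 + r * s * t) * of_bool (y = u))"
      by (simp add: distrib_right)
    then show False
      using apicesI[of u "1 + r * s * t"] edgeD[OF assms(1)] pos by force
  qed
  then show ?thesis
    using av pos edgeD[OF assms(1)] edgeD[OF assms(3)] unfolding edge_def by blast
qed

text \<open>A support of one point would make \<open>u\<close> an apex, so there is exactly one
  further point \<open>v\<close>. If \<open>v\<close> were an apex, subtracting its functional would
  again leave a multiple of the indicator of \<open>u\<close>.\<close>

lemma edge_of_small_support: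
  assumes h: "affine_values V h" "\<And>x. x \<in> V \<Longrightarrow> 0 \<le> h x" "card (supp V h) \<le> 2"
    and u: "u \<in> V" "0 < h u" "u \<notin> apices"
  obtains v where "v \<in> supp V h" "edge u v"
proof -
  have uS: "u \<in> supp V h" and fS: "finite (supp V h)"
    using u finite_V by (auto simp: supp_def)
  have "supp V h \<noteq> {u}"
  proof
    assume "supp V h = {u}"
    then have "affine_values V h \<longleftrightarrow> affine_values V (\<lambda>x. h u * of_bool (x = u))"
      by (intro affine_values_cong) (auto simp: supp_def)
    then show False using apicesI[of u "h u"] u h by simp
  qed
  then obtain v where v: "v \<in> supp V h" "v \<noteq> u" using uS by blast
  then have vV: "v \<in> V" "h v > 0" using h(2) by (auto simp: supp_def less_le)
  have S: "supp V h = {u, v}"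
    using v uS card_seteq[OF fS, of "{u, v}"] h(3) by simp
  have "affine_values V h \<longleftrightarrow> affine_values V (\<lambda>x. h u * of_bool (x = u) + h v * of_bool (x = v))"
    using S v(2) by (intro affine_values_cong) (auto simp: supp_def)
  then have av: "affine_values V (\<lambda>x. h u * of_bool (x = u) + h v * of_bool (x = v))"
    using h(1) by simp
  have "v \<notin> apices"
  proof
    assume "v \<in> apices"
    then have "affine_values V (\<lambda>x. h v * of_bool (x = v))"
      by (intro affine_values_scale) (simp add: apices_def)
    from affine_values_diff[OF av this] show False
      using apicesI[of u "h u"] u by simp
  qed
  moreover have "affine_values V (\<lambda>x. of_bool (x = u) + (h v / h u) * of_bool (x = v))"
    using affine_values_scale[OF av, of "1 / h u"] u by (simp add: distrib_left)
  ultimately have "edge u v"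
    using u vV v unfolding edge_def by (metis Diff_iff zero_less_divide_iff)
  then show ?thesis using that v by blast
qed

lemma edge_exists:
  assumes "u \<in> V - apices"
  shows "\<exists>v. edge u v"
proof -
  obtain h where "affine_values V h" "\<forall>x\<in>V. 0 \<le> h x" "0 < h u" "card (supp V h) \<le> 2"
    \<comment> \<open>The constant 1 vanishes nowhere, so it stands for the empty face.\<close>
    using cofacet[of "\<lambda>_. 1" u] affine_values_const assms by auto
  then show ?thesis
    using edge_of_small_support[of h u] assms by auto
qed

text \<open>Subtracting multiples of the functionals of apices and edges reduces every functional
  to a nonnegative one whose support contains no apex and no edge, and hence to 0. So these
  functionals span, and each of them lies inside or outside of a union of components.\<close>

lemma affine_values_restrict:
  assumes C: "\<And>u v. edge u v \<Longrightarrow> u \<in> C \<longleftrightarrow> v \<in> C" and g: "affine_values V g"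
  shows "affine_values V (\<lambda>x. if x \<in> C then g x else 0)"
  using g
\<comment> \<open>The weight 2 pays for an edge step on a nonnegative \<open>g\<close>: it shrinks
  the support but may create one negative value. An edge step at a negative value removes that value
  and does not enlarge the support.\<close>
proof (induction "2 * card (supp V g) + card {v\<in>V. g v < 0}" arbitrary: g rule: less_induct)
  case less
  have fin: "finite (supp V h)" "finite {v\<in>V. h v < 0}" for h :: "'a \<Rightarrow> real"
    using finite_V by (auto simp: supp_def)
  have edge_step: ?case
    if uv: "edge u v" "s > 0" "affine_values V (\<lambda>x. of_bool (x = u) + s * of_bool (x = v))"
      and less': "\<And>g'. (\<And>x. g' x = g x - g u * (of_bool (x = u) + s * of_bool (x = v))) \<Longrightarrow>
        2 * card (supp V g') + card {v\<in>V. g' v < 0} < 2 * card (supp V g) + card {v\<in>V. g v < 0}"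
    for u v s
  proof -
    define e where "e x = of_bool (x = u) + s * of_bool (x = v)" for x
    have e: "affine_values V e"
      using uv(3) unfolding e_def .
    define g' where "g' x = g x - g u * e x" for x
    have "affine_values V g'"
      using less.prems e unfolding g'_def by (intro affine_values_diff affine_values_scale)
    then have IH: "affine_values V (\<lambda>x. if x \<in> C then g' x else 0)"
      by (rule less.hyps[rotated]) (rule less', simp add: g'_def e_def)
    \<comment> \<open>\<open>C\<close> contains both ends of the edge or neither, so restricting the
      edge functional leaves it unchanged or kills it.\<close>
    have "(\<lambda>x. if x \<in> C then e x else 0) = (if u \<in> C then e else (\<lambda>x. 0))"
      using C[OF uv(1)] by (auto simp: e_def fun_eq_iff)
    then have "affine_values V (\<lambda>x. if x \<in> C then e x else 0)"
      using e affine_values_const[of V 0] by simp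
    then have "affine_values V (\<lambda>x. (if x \<in> C then g' x else 0) + g u * (if x \<in> C then e x else 0))"
      by (intro affine_values_add affine_values_scale IH)
    then show ?case
      by (rule back_subst[of "affine_values V"]) (auto simp: g'_def fun_eq_iff)
  qed
  have apex_step: ?case if u: "u \<in> apices" "g u \<noteq> 0" for u
  proof -
    have uV: "u \<in> V" and e: "affine_values V (\<lambda>x. of_bool (x = u))"
      using u by (auto simp: apices_def)
    define g' where "g' x = g x - g u * of_bool (x = u)" for x
    have "supp V g' = supp V g - {u}" "{v\<in>V. g' v < 0} \<subseteq> {v\<in>V. g v < 0}"
      by (auto simp: supp_def g'_def split: if_splits)
    moreover have "u \<in> supp V g" using u uV by (simp add: supp_def)
    ultimately have "card (supp V g') < card (supp V g)" "card {v\<in>V. g' v < 0} \<le> card {v\<in>V. g v < 0}"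
      using fin by (auto intro!: card_mono psubset_card_mono simp del: card_Diff_insert)
    moreover have "affine_values V g'"
      using less.prems e unfolding g'_def by (intro affine_values_diff affine_values_scale)
    ultimately have IH: "affine_values V (\<lambda>x. if x \<in> C then g' x else 0)"
      by (intro less.hyps) simp_all
    have "affine_values V (\<lambda>x. (if x \<in> C then g' x else 0) + (if u \<in> C then g u else 0) * of_bool (x = u))"
      using e by (intro affine_values_add affine_values_scale IH)
    then show ?case
      by (rule back_subst[of "affine_values V"]) (auto simp: g'_def fun_eq_iff)
  qed
  consider u where "u \<in> V" "g u < 0" | u where "\<And>x. x \<in> V \<Longrightarrow> 0 \<le> g x" "u \<in> V" "0 < g u"
    | "\<And>x. x \<in> V \<Longrightarrow> g x = 0"
    by (meson linorder_cases not_less)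
  then show ?case
  proof cases
    case (1 u)
    show ?thesis
    proof (cases "u \<in> apices")
      case False
      then obtain v s where uv: "edge u v" "s > 0"
        "affine_values V (\<lambda>x. of_bool (x = u) + s * of_bool (x = v))"
        using edge_exists[of u] 1 by (auto simp: edge_def)
      show ?thesis
      proof (rule edge_step[OF uv])
        fix g' assume g': "g' x = g x - g u * (of_bool (x = u) + s * of_bool (x = v))" for x
        \<comment> \<open>As \<open>g u\<close> is negative, the subtraction raises the value at
          \<open>v\<close>, so no new negative value arises.\<close>
        have gv: "g v \<le> g' v" and gu: "g' u = 0"
          using 1 uv(2) edgeD[OF uv(1)] by (auto simp: g' intro: mult_nonneg_nonpos2 mult_nonpos_nonneg)
        have "{v\<in>V. g' v < 0} \<subseteq> {v\<in>V. g v < 0} - {u}"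
          using gv gu by (auto simp: g' split: if_splits)
        then have "card {v\<in>V. g' v < 0} \<le> card ({v\<in>V. g v < 0} - {u})"
          by (intro card_mono) (use finite_V in auto)
        moreover have "card ({v\<in>V. g v < 0} - {u}) < card {v\<in>V. g v < 0}"
          using 1 by (intro psubset_card_mono fin) auto
        ultimately have neg: "card {v\<in>V. g' v < 0} < card {v\<in>V. g v < 0}" by simp
        have "supp V g' \<subseteq> insert v (supp V g - {u})"
          using gu by (auto simp: supp_def g' split: if_splits)
        then have "card (supp V g') \<le> card (insert v (supp V g - {u}))"
          by (intro card_mono) (use fin in auto)
        also have "\<dots> \<le> Suc (card (supp V g - {u}))"
          by (rule card_insert_le_m1) auto
        also have "\<dots> = card (supp V g)"
          using 1 fin by (intro card_Suc_Diff1) (auto simp: supp_def)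
        finally show "2 * card (supp V g') + card {v\<in>V. g' v < 0} < 2 * card (supp V g) + card {v\<in>V. g v < 0}"
          using neg by simp
      qed
    qed (use apex_step 1 in auto)
  next
    case (2 u)
    obtain h where h: "affine_values V h" "\<forall>x\<in>V. 0 \<le> h x" "0 < h u"
        "supp V h \<subseteq> supp V g" "card (supp V h) \<le> 2"
      using cofacet[OF less.prems 2] by blast
    show ?thesis
    proof (cases "u \<in> apices")
      case False
      then obtain v where v: "v \<in> supp V h" "edge u v"
        using edge_of_small_support[of h u] h 2 by auto
      then obtain s where s: "s > 0" "affine_values V (\<lambda>x. of_bool (x = u) + s * of_bool (x = v))"
        by (auto simp: edge_def)
      show ?thesis
      proof (rule edge_step[OF v(2) s])
        fix g' assume g': "g' x = g x - g u * (of_bool (x = u) + s * of_bool (x = v))" for x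
        have gu: "g' u = 0" using edgeD[OF v(2)] by (simp add: g')
        have "{v\<in>V. g' v < 0} \<subseteq> {v}"
          using 2 gu by (auto simp: g' split: if_splits) (metis not_less)+
        then have "card {v\<in>V. g' v < 0} \<le> card {v}"
          by (intro card_mono) auto
        \<comment> \<open>The other end \<open>v\<close> already lies in the support of
          \<open>g\<close>, because \<open>h\<close> was chosen with support inside it.\<close>
        moreover have "supp V g' \<subseteq> supp V g - {u}"
          using gu v(1) h(4) by (auto simp: supp_def g' split: if_splits)
        then have "card (supp V g') \<le> card (supp V g - {u})"
          by (intro card_mono) (use fin in auto)
        moreover have "Suc (card (supp V g - {u})) = card (supp V g)"
          using 2 fin by (intro card_Suc_Diff1) (auto simp: supp_def)
        ultimately show "2 * card (supp V g') + card {v\<in>V. g' v < 0} < 2 * card (supp V g) + card {v\<in>V. g v < 0}"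
          by simp
      qed
    qed (use apex_step 2 in auto)
  next
    case 3
    have "affine_values V (\<lambda>x. if x \<in> C then g x else 0) \<longleftrightarrow> affine_values V (\<lambda>x. 0)"
      using 3 by (intro affine_values_cong) auto
    then show ?thesis using affine_values_const by blast
  qed
qed

text \<open>Dual to \<open>affine_values_restrict\<close>: \<open>l\<close> annihilates the
  restriction of every functional to \<open>C\<close>, so its part on \<open>C\<close> annihilates
  every functional. Testing with \<open>w \<bullet> v\<close> and with 1 shows that this part is a
  relation.\<close>

lemma affine_relation_restrict:
  assumes C: "C \<subseteq> V" "\<And>u v. edge u v \<Longrightarrow> u \<in> C \<longleftrightarrow> v \<in> C" and l: "affine_relation V l"
  shows "affine_relation C l"
proof -
  have VC: "V \<inter> C = C" using C by auto
  have *: "(\<Sum>x\<in>C. l x * g x) = 0" if "affine_values V g" for g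
  proof -
    have "(\<Sum>x\<in>V. l x * (if x \<in> C then g x else 0)) = 0"
      using affine_valuesD[OF affine_values_restrict[OF C(2) that] l] by blast
    also have "(\<Sum>x\<in>V. l x * (if x \<in> C then g x else 0)) = (\<Sum>x\<in>V. if x \<in> C then l x * g x else 0)"
      by (intro sum.cong) auto
    finally show ?thesis
      using finite_V by (simp add: VC flip: sum.inter_restrict)
  qed
  have "w \<bullet> (\<Sum>v\<in>C. l v *\<^sub>R v) = 0" for w
    using *[of "\<lambda>v. w \<bullet> v"] affine_values_inner[of V w 0] by (simp add: inner_sum_right)
  then have "(\<Sum>v\<in>C. l v *\<^sub>R v) = 0"
    by (metis inner_eq_zero_iff)
  then show ?thesis
    using *[OF affine_values_const[of V 1]] by (simp add: affine_relation_def)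
qed

section \<open>Connected components, which are complete bipartite with sides \<open>A\<close> and
  \<open>B\<close>\<close>

definition component :: "'a set \<Rightarrow> 'a set \<Rightarrow> bool" where
  "component A B \<longleftrightarrow> A \<noteq> {} \<and> B \<noteq> {} \<and>
     (\<forall>x\<in>A. \<forall>y. edge x y \<longleftrightarrow> y \<in> B) \<and> (\<forall>y\<in>B. \<forall>x. edge x y \<longleftrightarrow> x \<in> A)"

lemma component_sym: "component A B \<Longrightarrow> component B A"
  using edge_sym unfolding component_def by blast

lemma component_edge: "component A B \<Longrightarrow> x \<in> A \<Longrightarrow> y \<in> B \<Longrightarrow> edge x y"
  by (simp add: component_def)

lemma component_subset: "component A B \<Longrightarrow> A \<union> B \<subseteq> V - apices"
  unfolding component_def edge_def by blast

lemma component_disjoint: "component A B \<Longrightarrow> A \<inter> B = {}"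
  using edgeD(5) unfolding component_def by blast

lemma component_saturated:
  "component A B \<Longrightarrow> edge u v \<Longrightarrow> u \<in> A \<union> B \<longleftrightarrow> v \<in> A \<union> B"
  using edge_sym unfolding component_def by blast

text \<open>For an edge from \<open>u\<close> to \<open>w\<close>, the sides are the neighbours of
  \<open>w\<close> and the neighbours of \<open>u\<close>; \<open>edge_path3\<close> joins all pairs
  between them.\<close>

lemma component_exists:
  assumes "u \<in> V - apices"
  obtains A B where "component A B" "u \<in> A"
proof -
  obtain w where w: "edge u w" using edge_exists[OF assms] by blast
  have wu: "edge w u" using w edge_sym by blast
  have "edge x y \<longleftrightarrow> edge u y" if "edge x w" for x y
    using that w wu edge_path3 edge_sym by blast
  moreover have "edge x y \<longleftrightarrow> edge x w" if "edge u y" for x y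
    using that w wu edge_path3 edge_sym by blast
  ultimately have "component {x. edge x w} {y. edge u y}"
    using w unfolding component_def by blast
  then show ?thesis using that w by blast
qed

text \<open>If \<open>a\<close> were alone on its side, take the functional vanishing exactly at the
  vertex \<open>a\<close>. A small support inside its support containing \<open>b\<close> would have
  to contain a neighbour of \<open>b\<close>, but the only neighbour is \<open>a\<close>.\<close>

lemma component_card:
  assumes "component A B"
  shows "2 \<le> card A"
proof (rule ccontr)
  assume "\<not> 2 \<le> card A"
  moreover have "A \<noteq> {}" "finite A"
    using assms component_subset[OF assms] finite_V finite_subset by (auto simp: component_def)
  ultimately have "card A = 1"
    using card_gt_0_iff[of A] by simp
  then obtain a where A: "A = {a}" by (auto simp: card_1_singleton_iff)
  obtain b where b: "b \<in> B" using assms by (auto simp: component_def)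
  have mem: "a \<in> V" "b \<in> V" "b \<notin> apices" "a \<noteq> b"
    using edgeD[OF component_edge[OF assms, of a b]] A b by auto
  obtain g where g: "affine_values V g" "\<forall>x\<in>V. 0 \<le> g x" "\<forall>x\<in>V. g x = 0 \<longleftrightarrow> x = a"
    using exposed[OF mem(1)] by blast
  then have "0 < g b" using mem by (metis less_eq_real_def)
  then obtain h where h: "affine_values V h" "\<forall>x\<in>V. 0 \<le> h x" "0 < h b"
      "supp V h \<subseteq> supp V g" "card (supp V h) \<le> 2"
    using cofacet[OF g(1) _ mem(2)] g(2) by blast
  then obtain v where "v \<in> supp V h" "edge b v"
    using edge_of_small_support[of h b] mem by auto
  then have "v \<in> supp V g" "v = a"
    using assms edge_sym b h(4) A unfolding component_def by blast+
  then show False using g mem by (simp add: supp_def)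
qed

text \<open>Every relation annihilates the functional of the edge. The ratio \<open>- s\<close>
  depends on the edge alone and is the same for all relations.\<close>

lemma edge_relation:
  assumes "edge u v" "C \<subseteq> V" "u \<in> C" "v \<in> C"
  obtains s where "s > 0" "\<And>l. affine_relation C l \<Longrightarrow> l u = - s * l v"
proof -
  obtain s where s: "s > 0" and av: "affine_values V (\<lambda>x. of_bool (x = u) + s * of_bool (x = v))"
    using assms(1) by (auto simp: edge_def)
  have finC: "finite C" using assms(2) finite_V finite_subset by blast
  have "l u = - s * l v" if "affine_relation C l" for l
  proof -
    have "(\<Sum>x\<in>C. l x * (of_bool (x = u) + s * of_bool (x = v))) = 0"
      by (rule affine_valuesD[OF affine_values_subset[OF finite_V assms(2) av] that])
    moreover have "(\<Sum>x\<in>C. l x * (of_bool (x = u) + s * of_bool (x = v)))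
        = (\<Sum>x\<in>C. if x = u then l x else 0) + (\<Sum>x\<in>C. if x = v then s * l x else 0)"
      by (simp add: sum.distrib[symmetric]) (intro sum.cong, auto simp: algebra_simps)
    ultimately show ?thesis using finC assms by simp
  qed
  then show ?thesis using that s by blast
qed

text \<open>Some relation is nonzero at a point \<open>a\<close>, as \<open>a\<close> is not an
  apex. The fixed negative ratios along the edges then determine all signs, and the relation up to a
  factor.\<close>

lemma component_relation:
  assumes AB: "component A B"
  obtains l where "affine_relation (A \<union> B) l" "\<And>x. x \<in> A \<Longrightarrow> 0 < l x" "\<And>x. x \<in> B \<Longrightarrow> l x < 0"
    "\<And>l'. affine_relation (A \<union> B) l' \<Longrightarrow> \<exists>c. \<forall>x\<in>A \<union> B. l' x = c * l x"
proof -
  let ?C = "A \<union> B"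
  obtain a b where ab: "a \<in> A" "b \<in> B" using AB by (auto simp: component_def)
  have CV: "?C \<subseteq> V" and finC: "finite ?C"
    using component_subset[OF AB] finite_V finite_subset by blast+
  have ratio: "\<exists>s>0. \<forall>l. affine_relation ?C l \<longrightarrow> l x = - s * l y" if "x \<in> A" "y \<in> B" for x y
    using edge_relation[OF component_edge[OF AB that] CV] that by (metis UnCI)
  \<comment> \<open>A functional on a component extends by zero to \<open>V\<close>, so this
    indicator would make \<open>a\<close> an apex of the whole.\<close>
  have "\<not> affine_values ?C (\<lambda>x. of_bool (x = a))"
  proof
    assume "affine_values ?C (\<lambda>x. of_bool (x = a))"
    then obtain w c where wc: "\<forall>x\<in>?C. of_bool (x = a) = w \<bullet> x + c"
      using affine_values_iff[OF finC, of "\<lambda>x. of_bool (x = a)"] by blast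
    have "affine_values V (\<lambda>x. if x \<in> ?C then w \<bullet> x + c else 0)"
      by (intro affine_values_restrict affine_values_inner component_saturated[OF AB])
    moreover have "(\<lambda>x. if x \<in> ?C then w \<bullet> x + c else 0) = (\<lambda>x. of_bool (x = a))"
      using wc ab by (auto simp: fun_eq_iff)
    ultimately have "a \<in> apices" using ab CV by (auto simp: apices_def)
    then show False using component_subset[OF AB] ab by blast
  qed
  then obtain l0 where l0: "affine_relation ?C l0" "(\<Sum>x\<in>?C. l0 x * of_bool (x = a)) \<noteq> 0"
    by (auto simp: affine_values_def)
  have "(\<Sum>x\<in>?C. l0 x * of_bool (x = a)) = (\<Sum>x\<in>?C. if x = a then l0 x else 0)"
    by (intro sum.cong) auto
  then have a0: "l0 a \<noteq> 0" using l0 finC ab by simp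
  define l where "l x = l0 x / l0 a" for x
  have l: "affine_relation ?C l"
    using l0(1) unfolding affine_relation_def l_def
    by (simp add: divide_inverse_commute flip: sum_distrib_left scaleR_scaleR scaleR_sum_right)
  have la: "l a = 1" using a0 by (simp add: l_def)
  have neg: "l y < 0" if y: "y \<in> B" for y
  proof -
    obtain s where s: "s > 0" "l a = - s * l y"
      using ratio[OF ab(1) y] l by blast
    then have "s * l y < 0" using la by simp
    then show ?thesis using s(1) by (simp add: mult_less_0_iff)
  qed
  have pos: "0 < l x" if x: "x \<in> A" for x
  proof -
    obtain s where "s > 0" "l x = - s * l b"
      using ratio[OF x ab(2)] l by blast
    then show ?thesis using neg[OF ab(2)] by (simp add: mult_pos_neg)
  qed
  have "\<exists>c. \<forall>x\<in>?C. l' x = c * l x" if l': "affine_relation ?C l'" for l'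
  proof -
    have B: "l' y = l' a * l y" if y: "y \<in> B" for y
    proof -
      obtain s where s: "l a = - s * l y" "l' a = - s * l' y"
        using ratio[OF ab(1) y] l l' by blast
      have "l' a * l y = (- s * l y) * l' y" by (simp add: s(2))
      then show ?thesis using la s(1) by simp
    qed
    have "l' x = l' a * l x" if x: "x \<in> A" for x
    proof -
      obtain s where "s > 0" "l x = - s * l b" "l' x = - s * l' b"
        using ratio[OF x ab(2)] l l' by blast
      then show ?thesis using B[OF ab(2)] by simp
    qed
    then show ?thesis using B by blast
  qed
  then show ?thesis using that[OF l pos neg] by blast
qed

end

section \<open>Point sets with a single affine relation as direct sums of two simplices\<close>

lemma simplex_translation:
  assumes "\<not> affine_dependent A" "A \<noteq> {}"
  shows "int (card A - 1) simplex ((+) p ` (convex hull A))"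
proof -
  have "card A > 0"
    using assms aff_independent_finite card_gt_0_iff by blast
  then have "int (card A - 1) simplex (convex hull ((+) p ` A))"
    using assms(1) affine_dependent_translation_eq[of A p]
    by (intro simplex_convex_hull) (auto simp: card_image inj_on_def)
  then show ?thesis by (simp add: convex_hull_translation)
qed

lemma affine_copy_translation: "affine_copy S ((+) p ` S)"
  unfolding affine_copy_def
  by (intro exI[of _ id] exI[of _ p]) (auto simp: inj_on_def linear_iff)

lemma affine_copy_refl: "affine_copy S S"
  using affine_copy_translation[of S 0] by simp

lemma span_translation_convex_hull:
  assumes "p \<in> affine hull S"
  shows "span ((+) (-p) ` (convex hull S)) = (+) (-p) ` (affine hull S)"
proof -
  have eq: "affine hull ((+) (-p) ` (convex hull S)) = (+) (-p) ` (affine hull S)"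
    by (metis affine_hull_convex_hull affine_hull_translation)
  have "0 \<in> (+) (-p) ` (affine hull S)"
    using assms by (force intro: image_eqI[of _ _ p])
  then show ?thesis
    using affine_hull_span_0 eq by metis
qed

text \<open>The common center \<open>p\<close> is the Radon point: scaled to total weight 1, the
  positive and the negative part of \<open>l\<close> represent the same point, in the relative
  interior of both simplices. Translating it to the origin gives the direct sum.\<close>

lemma circuit_direct_sum:
  fixes A B :: "'a::euclidean_space set"
  assumes fin: "finite A" "finite B" and ne: "A \<noteq> {}" "B \<noteq> {}" and disj: "A \<inter> B = {}"
    and l: "affine_relation (A \<union> B) l" "\<And>x. x \<in> A \<Longrightarrow> 0 < l x" "\<And>x. x \<in> B \<Longrightarrow> l x < 0"
    and uniq: "\<And>l'. affine_relation (A \<union> B) l' \<Longrightarrow> \<exists>c. \<forall>x\<in>A \<union> B. l' x = c * l x"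
  obtains p where "\<not> affine_dependent A" "\<not> affine_dependent B"
    "is_direct_sum ((+) (-p) ` (convex hull A)) ((+) (-p) ` (convex hull B))
       ((+) (-p) ` (convex hull (A \<union> B)))"
proof -
  \<comment> \<open>A dependence within \<open>X\<close> extends by zero to a multiple of
    \<open>l\<close>. It vanishes on \<open>Y\<close>, where \<open>l\<close> does not, so the
    factor is 0.\<close>
  have ind: "\<not> affine_dependent X" if XY: "X \<union> Y = A \<union> B" "X \<inter> Y = {}" "Y \<noteq> {}" for X Y
  proof
    have finX: "finite X" "finite (A \<union> B)" using XY fin by (metis finite_UnI finite_Un)+
    assume "affine_dependent X"
    then obtain m where m: "affine_relation X m" "\<exists>x\<in>X. m x \<noteq> 0"
      using affine_dependent_iff_relation[OF finX(1)] by blast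
    have "affine_relation (A \<union> B) (\<lambda>x. if x \<in> X then m x else 0)"
      using affine_relation_extend[OF finX(2) _ m(1)] XY by blast
    then obtain c where c: "\<forall>x\<in>A \<union> B. (if x \<in> X then m x else 0) = c * l x"
      using uniq by blast
    obtain y where y: "y \<in> Y" using XY(3) by blast
    then have yAB: "y \<in> A \<union> B" and "y \<notin> X" using XY by auto
    then have "c * l y = 0" using c[rule_format, OF yAB] by simp
    moreover have "l y \<noteq> 0" using yAB l(2)[of y] l(3)[of y] by auto
    ultimately have "c = 0" by simp
    then show False using m(2) c XY(1) by (metis UnCI mult_zero_left)
  qed
  have indA: "\<not> affine_dependent A" and indB: "\<not> affine_dependent B"
    using disj ne by (intro ind[of A B] ind[of B A]; blast)+
  define s where "s = sum l A"
  have s: "s > 0" using fin ne l(2) by (simp add: s_def sum_pos)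
  have sB: "(\<Sum>x\<in>B. - l x) = s" and vB: "(\<Sum>x\<in>B. - l x *\<^sub>R x) = (\<Sum>x\<in>A. l x *\<^sub>R x)"
    using l(1) fin disj by (simp_all add: affine_relation_def s_def sum.union_disjoint sum_negf add_eq_0_iff)
  define p where "p = (\<Sum>x\<in>A. (l x / s) *\<^sub>R x)"
  have sA1: "(\<Sum>x\<in>A. l x / s) = 1" using s by (simp add: s_def flip: sum_divide_distrib)
  have sB1: "(\<Sum>x\<in>B. - l x / s) = 1" using s sB by (simp only: sum_divide_distrib[symmetric]) simp
  have pB: "p = (\<Sum>x\<in>B. (- l x / s) *\<^sub>R x)"
  proof -
    have "(1/s) *\<^sub>R (\<Sum>x\<in>B. - l x *\<^sub>R x) = (1/s) *\<^sub>R (\<Sum>x\<in>A. l x *\<^sub>R x)"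
      by (simp only: vB)
    then show ?thesis by (simp add: p_def scaleR_sum_right)
  qed
  have pA_rel: "p \<in> rel_interior (convex hull A)"
    unfolding rel_interior_convex_hull_explicit[OF indA] mem_Collect_eq
    using l(2) s sA1 p_def by (intro exI[of _ "\<lambda>x. l x / s"]) auto
  have pB_rel: "p \<in> rel_interior (convex hull B)"
    unfolding rel_interior_convex_hull_explicit[OF indB] mem_Collect_eq
    using l(3) s sB1 pB by (intro exI[of _ "\<lambda>x. - l x / s"]) (auto simp: field_simps)
  have pA: "p \<in> affine hull A" and pB': "p \<in> affine hull B"
    using pA_rel pB_rel rel_interior_subset convex_hull_subset_affine_hull by blast+
  have meet: "y = p" if y: "y \<in> affine hull A" "y \<in> affine hull B" for y
  proof -
    obtain a b where a: "sum a A = 1" "(\<Sum>v\<in>A. a v *\<^sub>R v) = y"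
      and b: "sum b B = 1" "(\<Sum>v\<in>B. b v *\<^sub>R v) = y"
      using y fin by (auto simp: affine_hull_finite)
    \<comment> \<open>Two representations of a common point differ by a relation, hence by a
      multiple of \<open>l\<close>. Coefficient sum 1 on \<open>A\<close> fixes the factor as
      \<open>1/s\<close>, so the point is \<open>p\<close>.\<close>
    define m where "m x = (if x \<in> A then a x else - b x)" for x
    have "sum m A = 1" "(\<Sum>v\<in>A. m v *\<^sub>R v) = y"
      using a by (simp_all add: m_def cong: sum.cong)
    moreover have "sum m B = (\<Sum>v\<in>B. - b v)" "(\<Sum>v\<in>B. m v *\<^sub>R v) = (\<Sum>v\<in>B. - (b v *\<^sub>R v))"
      using disj by (auto simp: m_def intro!: sum.cong)
    ultimately have "affine_relation (A \<union> B) m"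
      using b fin disj by (simp add: affine_relation_def sum.union_disjoint sum_negf)
    then obtain c where m: "\<forall>x\<in>A \<union> B. m x = c * l x" using uniq by blast
    have c: "a x = c * l x" if "x \<in> A" for x
      using m[rule_format, of x] that by (simp add: m_def)
    then have "sum a A = c * s" by (simp add: s_def sum_distrib_left)
    then have "c = 1/s" using a s by (simp add: field_simps)
    then show ?thesis using a(2) c by (simp add: p_def)
  qed
  have "span ((+) (-p) ` (convex hull A)) \<inter> span ((+) (-p) ` (convex hull B)) = {0}"
    unfolding span_translation_convex_hull[OF pA] span_translation_convex_hull[OF pB']
  proof (intro equalityI subsetI)
    fix z assume "z \<in> (+) (-p) ` (affine hull A) \<inter> (+) (-p) ` (affine hull B)"
    then have "p + z \<in> affine hull A" "p + z \<in> affine hull B" by auto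
    then show "z \<in> {0}" using meet[of "p + z"] by simp
  next
    fix z :: 'a assume "z \<in> {0}"
    then have "z = - p + p" by simp
    then show "z \<in> (+) (-p) ` (affine hull A) \<inter> (+) (-p) ` (affine hull B)"
      using pA pB' by blast
  qed
  moreover have "0 \<in> rel_interior ((+) (-p) ` (convex hull A))" "0 \<in> rel_interior ((+) (-p) ` (convex hull B))"
    unfolding rel_interior_translation
    using pA_rel pB_rel by (auto intro!: image_eqI[of _ _ p])
  moreover have "(+) (-p) ` (convex hull (A \<union> B)) =
      convex hull ((+) (-p) ` (convex hull A) \<union> (+) (-p) ` (convex hull B))"
    by (simp only: hull_Un[of convex A B, OF convex_Inter] image_Un convex_hull_translation[symmetric])
  ultimately have "is_direct_sum ((+) (-p) ` (convex hull A)) ((+) (-p) ` (convex hull B))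
       ((+) (-p) ` (convex hull (A \<union> B)))"
    unfolding is_direct_sum_def
    by (intro exI[of _ "(+) (-p) ` (convex hull A)"] exI[of _ "(+) (-p) ` (convex hull B)"])
       (simp add: affine_copy_refl)
  then show ?thesis using that indA indB by blast
qed

section \<open>Assembling the polytope from its apices and components\<close>

context small_cofacets
begin

text \<open>All apices together with a union of components.\<close>

definition saturated :: "'a set \<Rightarrow> bool" where
  "saturated X \<longleftrightarrow> apices \<subseteq> X \<and> X \<subseteq> V \<and> (\<forall>u v. edge u v \<longrightarrow> (u \<in> X \<longleftrightarrow> v \<in> X))"

lemma saturatedD:
  assumes "saturated X"
  shows "apices \<subseteq> X" "X \<subseteq> V" "edge u v \<Longrightarrow> u \<in> X \<longleftrightarrow> v \<in> X"
  using assms unfolding saturated_def by blast+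

text \<open>Removing the component of a point that is not an apex leaves a smaller saturated set.
  The step retains \<open>saturated X\<close>, so that relations of \<open>V\<close> can be
  restricted to \<open>X\<close>.\<close>

lemma component_induct:
  assumes apices: "P apices"
    and step: "\<And>X A B. \<lbrakk>saturated X; component A B; X \<inter> (A \<union> B) = {}; P X\<rbrakk> \<Longrightarrow> P (X \<union> (A \<union> B))"
  shows "P V"
proof -
  have "P X" if "saturated X" for X
    using that
  proof (induction "card X" arbitrary: X rule: less_induct)
    case less
    have finX: "finite X"
      using saturatedD(2)[OF less.prems] finite_V finite_subset by blast
    show ?case
    proof (cases "X = apices")
      case False
      then obtain u where u: "u \<in> X" "u \<in> V - apices"
        using saturatedD[OF less.prems] by blast
      obtain A B where AB: "component A B" "u \<in> A" using component_exists[OF u(2)] by blast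
      have sub: "A \<union> B \<subseteq> X"
      proof -
        have "B \<subseteq> X"
          using saturatedD(3)[OF less.prems component_edge[OF AB]] u(1) by blast
        moreover obtain b where "b \<in> B" using AB(1) by (auto simp: component_def)
        ultimately show ?thesis
          using saturatedD(3)[OF less.prems component_edge[OF AB(1) _ \<open>b \<in> B\<close>]] by blast
      qed
      have sat: "saturated (X - (A \<union> B))"
        unfolding saturated_def
      proof (intro conjI allI impI)
        have "apices \<inter> (A \<union> B) = {}"
          using component_subset[OF AB(1)] by auto
        then show "apices \<subseteq> X - (A \<union> B)"
          using saturatedD(1)[OF less.prems] by auto
        show "X - (A \<union> B) \<subseteq> V"
          using saturatedD(2)[OF less.prems] by auto
        fix u v assume e: "edge u v"
        show "u \<in> X - (A \<union> B) \<longleftrightarrow> v \<in> X - (A \<union> B)"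
          using saturatedD(3)[OF less.prems e] component_saturated[OF AB(1) e] by simp
      qed
      have "X - (A \<union> B) \<subset> X" using AB(2) u(1) by blast
      then have "card (X - (A \<union> B)) < card X"
        by (rule psubset_card_mono[OF finX])
      then have "P (X - (A \<union> B))"
        using less.hyps sat by blast
      then have "P ((X - (A \<union> B)) \<union> (A \<union> B))"
        using step sat AB by blast
      then show ?thesis using sub by (simp add: Un_absorb2)
    qed (use apices in simp)
  qed
  moreover have "saturated V"
    unfolding saturated_def by (simp add: apices_def edge_def subset_iff)
  ultimately show ?thesis by blast
qed

text \<open>The indicator of an apex is a functional, so every relation vanishes there.\<close>

lemma affine_independent_apices: "\<not> affine_dependent apices"
proof -
  have sub: "apices \<subseteq> V" and fin: "finite apices"
    using finite_V by (auto simp: apices_def)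
  have "l v = 0" if l: "affine_relation apices l" and v: "v \<in> apices" for l v
  proof -
    have "affine_values V (\<lambda>x. of_bool (x = v))" using v by (simp add: apices_def)
    then have "(\<Sum>x\<in>apices. l x * of_bool (x = v)) = 0"
      using affine_valuesD[OF affine_values_subset[OF finite_V sub] l] by blast
    moreover have "(\<Sum>x\<in>apices. l x * of_bool (x = v)) = (\<Sum>x\<in>apices. if x = v then l x else 0)"
      by (intro sum.cong) auto
    ultimately show ?thesis using fin v by simp
  qed
  then show ?thesis
    using affine_dependent_iff_relation[OF fin] by blast
qed

text \<open>The apices span the simplex, and each component adds one join factor. Relations split
  along the components, which by \<open>skew_affine_hull_iff\<close> is the skewness needed for a
  join. No combinatorial change is made: the hull itself is the realization.\<close>

lemma simplex_sum_join_convex_hull: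
  "\<exists>n jks. (\<forall>(j, k)\<in>set jks. 1 \<le> j \<and> 1 \<le> k) \<and> simplex_sum_join n jks (convex hull V)"
proof (rule component_induct)
  have "simplex_sum_join (card apices) [] (convex hull apices)"
    by (intro simplex_sum_join.simplex simplex_convex_hull) (simp add: affine_independent_apices)
  then show "\<exists>n jks. (\<forall>(j, k)\<in>set jks. 1 \<le> j \<and> 1 \<le> k) \<and> simplex_sum_join n jks (convex hull apices)"
    by (intro exI[of _ "card apices"] exI[of _ "[]"]) simp
next
  fix X A B
  assume X: "saturated X" and AB: "component A B" and disj: "X \<inter> (A \<union> B) = {}"
    and "\<exists>n jks. (\<forall>(j, k)\<in>set jks. 1 \<le> j \<and> 1 \<le> k) \<and> simplex_sum_join n jks (convex hull X)"
  then obtain n jks where IH: "\<forall>(j, k)\<in>set jks. 1 \<le> j \<and> 1 \<le> k" "simplex_sum_join n jks (convex hull X)"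
    by blast
  let ?C = "A \<union> B"
  have sub: "X \<subseteq> V" "?C \<subseteq> V"
    using saturatedD(2)[OF X] component_subset[OF AB] by blast+
  then have fin: "finite X" "finite A" "finite B"
    using finite_V finite_subset by auto
  have ne: "A \<noteq> {}" "B \<noteq> {}" using AB by (auto simp: component_def)
  obtain l where l: "affine_relation ?C l" "\<And>x. x \<in> A \<Longrightarrow> 0 < l x" "\<And>x. x \<in> B \<Longrightarrow> l x < 0"
    "\<And>l'. affine_relation ?C l' \<Longrightarrow> \<exists>c. \<forall>x\<in>?C. l' x = c * l x"
    using component_relation[OF AB] by blast
  obtain p where p: "\<not> affine_dependent A" "\<not> affine_dependent B"
    "is_direct_sum ((+) (-p) ` (convex hull A)) ((+) (-p) ` (convex hull B)) ((+) (-p) ` (convex hull ?C))"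
    using circuit_direct_sum[OF fin(2,3) ne component_disjoint[OF AB] l] by blast
  have "affine_relation X m" if m: "affine_relation (X \<union> ?C) m" for m
  proof -
    define m' where "m' x = (if x \<in> X \<union> ?C then m x else 0)" for x
    have "affine_relation V m'"
      unfolding m'_def using affine_relation_extend[OF finite_V _ m] sub by blast
    then have "affine_relation X m'"
      using affine_relation_restrict[of X m'] saturatedD(2,3)[OF X] by blast
    then show ?thesis by (simp add: affine_relation_def m'_def cong: sum.cong)
  qed
  then have skew: "skew (affine hull X) (affine hull ?C)"
    using disj skew_affine_hull_iff[OF fin(1) finite_UnI[OF fin(2,3)]] by blast
  \<comment> \<open>The direct sum is centered at the origin, while the join uses the hull in its
    original place; translation by \<open>p\<close> moves it back.\<close>
  have copy: "affine_copy ((+) (-p) ` (convex hull ?C)) (convex hull ?C)"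
    using affine_copy_translation[of "(+) (-p) ` (convex hull ?C)" p] by (simp add: image_image)
  have "is_join (convex hull X) ((+) (-p) ` (convex hull ?C)) (convex hull (X \<union> ?C))"
    unfolding is_join_def
  proof (intro exI conjI)
    show "convex hull (X \<union> ?C) = convex hull (convex hull X \<union> convex hull ?C)"
      by (rule hull_Un) (simp add: convex_Inter)
  qed (use skew copy affine_copy_refl in simp_all)
  then have "simplex_sum_join n (jks @ [(card A - 1, card B - 1)]) (convex hull (X \<union> ?C))"
    using simplex_sum_join.join IH(2) simplex_translation p ne by blast
  moreover have "1 \<le> card A - 1" "1 \<le> card B - 1"
    using component_card[OF AB] component_card[OF component_sym[OF AB]] by auto
  ultimately show "\<exists>n jks. (\<forall>(j, k)\<in>set jks. 1 \<le> j \<and> 1 \<le> k) \<and> simplex_sum_join n jks (convex hull (X \<union> ?C))"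
    using IH(1) by (intro exI[of _ n] exI[of _ "jks @ [(card A - 1, card B - 1)]"]) auto
qed

text \<open>A transversal \<open>T\<close> of the components that avoids \<open>W\<close> has an affinely independent complement.
  A second one on the other sides of the components is disjoint from \<open>T\<close>, whence the factor 2.\<close>

lemma card_simplex_face_le:
  assumes W: "W \<subseteq> V" "\<not> affine_dependent W"
    and g: "affine_values V g" "\<And>x. x \<in> V \<Longrightarrow> 0 \<le> g x" "\<And>x. x \<in> V \<Longrightarrow> g x = 0 \<longleftrightarrow> x \<in> W"
  shows "int (card V) + int (card W) \<le> 2 * (aff_dim V + 1)"
proof -
  have "\<exists>T\<subseteq>V. 2 * card T \<le> card (V - W) \<and>
      (\<forall>l. affine_relation V l \<longrightarrow> (\<forall>x\<in>T. l x = 0) \<longrightarrow> (\<forall>x\<in>V. l x = 0))"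
  \<comment> \<open>The invariant keeps relations of all of \<open>V\<close>, while counting and
    vanishing concern only the part \<open>X\<close> assembled so far.\<close>
  proof (rule component_induct[where P = "\<lambda>X. \<exists>T\<subseteq>X. 2 * card T \<le> card (X - W) \<and>
      (\<forall>l. affine_relation V l \<longrightarrow> (\<forall>x\<in>T. l x = 0) \<longrightarrow> (\<forall>x\<in>X. l x = 0))"])
    have "l x = 0" if l: "affine_relation V l" and x: "x \<in> apices" for l x
    proof -
      have "affine_values V (\<lambda>y. of_bool (y = x))" using x by (simp add: apices_def)
      then have "(\<Sum>y\<in>V. l y * of_bool (y = x)) = 0"
        using affine_valuesD l by blast
      moreover have "(\<Sum>y\<in>V. l y * of_bool (y = x)) = (\<Sum>y\<in>V. if y = x then l y else 0)"
        by (intro sum.cong) auto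
      ultimately show ?thesis using finite_V x by (simp add: apices_def)
    qed
    then show "\<exists>T\<subseteq>apices. 2 * card T \<le> card (apices - W) \<and>
      (\<forall>l. affine_relation V l \<longrightarrow> (\<forall>x\<in>T. l x = 0) \<longrightarrow> (\<forall>x\<in>apices. l x = 0))"
      by (intro exI[of _ "{}"]) auto
  next
    fix X A B
    assume X: "saturated X" and AB: "component A B" and disj: "X \<inter> (A \<union> B) = {}"
      and "\<exists>T\<subseteq>X. 2 * card T \<le> card (X - W) \<and>
        (\<forall>l. affine_relation V l \<longrightarrow> (\<forall>x\<in>T. l x = 0) \<longrightarrow> (\<forall>x\<in>X. l x = 0))"
    then obtain T where T: "T \<subseteq> X" "2 * card T \<le> card (X - W)"
      "\<And>l. affine_relation V l \<Longrightarrow> \<forall>x\<in>T. l x = 0 \<Longrightarrow> \<forall>x\<in>X. l x = 0"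
      by blast
    have sub: "X \<subseteq> V" "A \<union> B \<subseteq> V"
      using saturatedD(2)[OF X] component_subset[OF AB] by blast+
    have fin: "finite X" "finite T" "finite (A \<union> B)"
      using sub T(1) finite_V finite_subset by metis+
    \<comment> \<open>If one side lies in the face, the component's relation pairs with
      \<open>g\<close> to a sum of terms of one sign over the other side. So that side lies in the
      face too, and the relation makes \<open>W\<close> dependent.\<close>
    have not_sub: "\<not> A \<subseteq> W" if AB: "component A B" for A B
    proof
      assume "A \<subseteq> W"
      obtain l where l: "affine_relation (A \<union> B) l" "\<And>x. x \<in> A \<Longrightarrow> 0 < l x" "\<And>x. x \<in> B \<Longrightarrow> l x < 0"
        by (rule component_relation[OF AB]) (rule that)
      have sub: "A \<union> B \<subseteq> V" using component_subset[OF AB] by auto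
      then have fin: "finite A" "finite B" "finite W"
        using finite_V W(1) finite_subset by auto
      have "0 = (\<Sum>x\<in>A \<union> B. l x * g x)"
        using affine_valuesD[OF affine_values_subset[OF finite_V sub g(1)] l(1)] by simp
      also have "\<dots> = (\<Sum>x\<in>A. l x * g x) + (\<Sum>x\<in>B. l x * g x)"
        using fin component_disjoint[OF AB] by (intro sum.union_disjoint)
      also have "(\<Sum>x\<in>A. l x * g x) = 0"
        using \<open>A \<subseteq> W\<close> g(3) sub by (intro sum.neutral) auto
      finally have "(\<Sum>x\<in>B. - (l x * g x)) = 0" by (simp add: sum_negf)
      moreover have "0 \<le> - (l x * g x)" if "x \<in> B" for x
        using l(3)[OF that] g(2)[OF subsetD[OF sub, of x]] that by (auto simp: mult_le_0_iff)
      ultimately have "\<forall>x\<in>B. l x * g x = 0"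
        using fin by (subst (asm) sum_nonneg_eq_0_iff) auto
      then have "B \<subseteq> W"
        using l(3) g(3) sub by (metis Un_subset_iff less_irrefl mult_eq_0_iff subset_iff)
      with \<open>A \<subseteq> W\<close> have "affine_relation W (\<lambda>x. if x \<in> A \<union> B then l x else 0)"
        using affine_relation_extend[OF fin(3) _ l(1)] by blast
      moreover obtain a where a: "a \<in> A" using AB by (auto simp: component_def)
      moreover have "a \<in> W" "l a \<noteq> 0" using a l(2)[OF a] \<open>A \<subseteq> W\<close> by auto
      ultimately have "affine_dependent W"
        unfolding affine_dependent_iff_relation[OF fin(3)]
        by (intro exI[of _ "\<lambda>x. if x \<in> A \<union> B then l x else 0"] conjI bexI[of _ a]) simp_all
      then show False using W(2) by blast
    qed
    obtain a b where ab: "a \<in> A - W" "b \<in> B - W"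
      using not_sub[OF AB] not_sub[OF component_sym[OF AB]] by blast
    have anb: "a \<noteq> b" using ab component_disjoint[OF AB] by blast
    have "a \<notin> T" using ab T(1) disj by blast
    \<comment> \<open>Only \<open>a\<close> joins the transversal, but both \<open>a\<close> and
      \<open>b\<close> are outside \<open>W\<close>.\<close>
    then have "2 * card (insert a T) = 2 * card T + card {a, b}"
      using fin anb by simp
    also have "\<dots> \<le> card (X - W) + card {a, b}" using T(2) by simp
    also have "\<dots> = card ((X - W) \<union> {a, b})"
      using fin disj ab by (intro card_Un_disjoint[symmetric]) auto
    also have "\<dots> \<le> card ((X \<union> (A \<union> B)) - W)"
      using fin ab by (intro card_mono) auto
    finally have count: "2 * card (insert a T) \<le> card ((X \<union> (A \<union> B)) - W)" .
    have vanish: "\<forall>x\<in>X \<union> (A \<union> B). l x = 0"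
      if l: "affine_relation V l" "\<forall>x\<in>insert a T. l x = 0" for l
    proof -
      have eq: "l x = 0 \<longleftrightarrow> l y = 0" if xy: "x \<in> A" "y \<in> B" for x y
      proof -
        have "x \<in> V" "y \<in> V" using xy sub by auto
        then obtain s where "s > 0" "l x = - s * l y"
          using edge_relation[OF component_edge[OF AB xy] subset_refl] l(1) by metis
        then show ?thesis by auto
      qed
      have "l y = 0" if "y \<in> B" for y
        using eq[of a y] l(2) ab that by auto
      then have "l x = 0" if "x \<in> A" for x
        using eq[of x b] ab that by auto
      then show ?thesis
        using \<open>\<And>y. y \<in> B \<Longrightarrow> l y = 0\<close> T(3) l by blast
    qed
    have "insert a T \<subseteq> X \<union> (A \<union> B)" using T(1) ab by auto
    then show "\<exists>T\<subseteq>X \<union> (A \<union> B). 2 * card T \<le> card ((X \<union> (A \<union> B)) - W) \<and>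
        (\<forall>l. affine_relation V l \<longrightarrow> (\<forall>x\<in>T. l x = 0) \<longrightarrow> (\<forall>x\<in>X \<union> (A \<union> B). l x = 0))"
      using count vanish by (intro exI[of _ "insert a T"] conjI allI impI)
  qed
  then obtain T where T: "T \<subseteq> V" "2 * card T \<le> card (V - W)"
      "\<And>l. affine_relation V l \<Longrightarrow> \<forall>x\<in>T. l x = 0 \<Longrightarrow> \<forall>x\<in>V. l x = 0"
    by blast
  \<comment> \<open>A relation on \<open>V - T\<close>, extended by zero, vanishes on
    \<open>T\<close> and hence everywhere. So \<open>card V - card T\<close> is at most the
    dimension plus 1, and doubling this gives the bound.\<close>
  have ind: "\<not> affine_dependent (V - T)"
  proof
    assume "affine_dependent (V - T)"
    then obtain l where l: "affine_relation (V - T) l" "\<exists>v\<in>V - T. l v \<noteq> 0"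
      using affine_dependent_iff_relation[of "V - T"] finite_V by auto
    have "affine_relation V (\<lambda>x. if x \<in> V - T then l x else 0)"
      by (rule affine_relation_extend[OF finite_V Diff_subset l(1)])
    from T(3)[OF this] show False using l(2) by auto
  qed
  have "int (card (V - T)) = aff_dim (V - T) + 1"
    using aff_dim_affine_independent[OF ind] by simp
  also have "\<dots> \<le> aff_dim V + 1" by (simp add: aff_dim_subset)
  finally have "int (card (V - T)) \<le> aff_dim V + 1" .
  moreover have "card (V - T) + card T = card V" "card (V - W) + card W = card V"
    using T(1) W(1) finite_V finite_subset[OF _ finite_V] by (simp_all add: card_Diff_subset card_mono)
  then have "int (card (V - T)) + int (card T) = int (card V)"
    "int (card (V - W)) + int (card W) = int (card V)"
    by (metis of_nat_add)+
  moreover have "2 * int (card T) \<le> int (card (V - W))" using T(2) by linarith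
  ultimately show ?thesis by simp
qed

end

subsection \<open>Joins of direct sums of simplices\<close>

text \<open>Weaker than \<open>cofacet\<close>, since \<open>h\<close> need not be positive at a
  prescribed point. This is enough for maximal proper faces, and it is checked factor by factor in a
  join.\<close>

definition has_small_cofaces :: "'a::real_vector set \<Rightarrow> bool" where
  "has_small_cofaces V \<longleftrightarrow> finite V \<and>
     (\<forall>g. affine_values V g \<longrightarrow> (\<forall>x\<in>V. 0 \<le> g x) \<longrightarrow> supp V g \<noteq> {} \<longrightarrow>
       (\<exists>h. affine_values V h \<and> (\<forall>x\<in>V. 0 \<le> h x) \<and> supp V h \<noteq> {} \<and>
            supp V h \<subseteq> supp V g \<and> card (supp V h) \<le> 2))"

lemma has_small_cofacesD:
  assumes "has_small_cofaces V" "affine_values V g" "\<forall>x\<in>V. 0 \<le> g x" "supp V g \<noteq> {}"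
  shows "\<exists>h. affine_values V h \<and> (\<forall>x\<in>V. 0 \<le> h x) \<and> supp V h \<noteq> {} \<and>
    supp V h \<subseteq> supp V g \<and> card (supp V h) \<le> 2"
  using assms unfolding has_small_cofaces_def by blast

text \<open>On an affinely independent set every function is a functional, so the indicator of a
  single point will do.\<close>

lemma has_small_cofaces_simplex:
  fixes V :: "'a::euclidean_space set"
  assumes "\<not> affine_dependent V"
  shows "has_small_cofaces V"
  unfolding has_small_cofaces_def
proof (intro conjI allI impI)
  show "finite V" by (rule aff_independent_finite[OF assms])
  fix g assume "supp V g \<noteq> {}"
  then obtain u where u: "u \<in> V" "g u \<noteq> 0" by (auto simp: supp_def)
  have "supp V (\<lambda>x. of_bool (x = u)) = {u}" using u by (auto simp: supp_def)
  then show "\<exists>h. affine_values V h \<and> (\<forall>x\<in>V. 0 \<le> h x) \<and> supp V h \<noteq> {} \<and>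
            supp V h \<subseteq> supp V g \<and> card (supp V h) \<le> 2"
    using u by (intro exI[of _ "\<lambda>x. of_bool (x = u)"])
      (simp add: supp_def affine_independent_affine_values[OF assms])
qed

lemma affine_copy_convex_hull:
  fixes V :: "'a::euclidean_space set" and P :: "'b::euclidean_space set"
  assumes fin: "finite V" and copy: "affine_copy (convex hull V) P"
  obtains F where "P = convex hull (F ` V)" "inj_on F V"
    "\<And>l. affine_relation (F ` V) l \<longleftrightarrow> affine_relation V (l \<circ> F)"
proof -
  obtain f c where f: "linear f" and inj: "inj_on (\<lambda>x. c + f x) (affine hull V)"
    and P: "P = (\<lambda>x. c + f x) ` (convex hull V)"
    using copy by (auto simp: affine_copy_def)
  define F where "F x = c + f x" for x
  have injV: "inj_on F V"
    using inj_on_subset[OF inj hull_subset] by (simp add: F_def[abs_def])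
  have "P = (+) c ` f ` (convex hull V)"
    unfolding P by (simp add: image_image)
  also have "\<dots> = convex hull (F ` V)"
    unfolding convex_hull_linear_image[OF f] convex_hull_translation[symmetric]
    by (simp add: image_image F_def[abs_def])
  finally have hull: "P = convex hull (F ` V)" .
  have "affine_relation (F ` V) l \<longleftrightarrow> affine_relation V (l \<circ> F)" for l
  proof -
    define x where "x = (\<Sum>v\<in>V. l (F v) *\<^sub>R v)"
    have s: "sum l (F ` V) = sum (l \<circ> F) V"
      by (simp add: sum.reindex[OF injV])
    have "(\<Sum>y\<in>F ` V. l y *\<^sub>R y) = (\<Sum>v\<in>V. l (F v) *\<^sub>R F v)"
      by (simp add: sum.reindex[OF injV])
    also have "\<dots> = (\<Sum>v\<in>V. l (F v) *\<^sub>R (c + f v))"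
      by (simp add: F_def)
    also have "\<dots> = sum (l \<circ> F) V *\<^sub>R c + f x"
      by (simp add: x_def linear_sum[OF f] linear_cmul[OF f] scaleR_right_distrib sum.distrib scaleR_sum_left)
    finally have v: "(\<Sum>y\<in>F ` V. l y *\<^sub>R y) = sum (l \<circ> F) V *\<^sub>R c + f x" .
    \<comment> \<open>Here \<open>x\<close> is a direction killed by \<open>f\<close>, so
      \<open>u\<close> and \<open>u + x\<close> have the same image; injectivity on the affine hull
      forces \<open>x = 0\<close>.\<close>
    have "x = 0" if s0: "sum (l \<circ> F) V = 0" and fx: "f x = 0"
    proof (cases "V = {}")
      case False
      then obtain u where u: "u \<in> V" by blast
      have "u + x \<in> affine hull V"
        using add_mem_affine_hull[OF fin u] s0 by (simp add: x_def)
      moreover have "c + f (u + x) = c + f u" by (simp add: linear_add[OF f] fx)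
      ultimately have "u + x = u" using inj_onD[OF inj] u hull_inc by metis
      then show ?thesis by simp
    qed (simp add: x_def)
    then show ?thesis
      unfolding affine_relation_def s v using linear_0[OF f] by (auto simp: x_def)
  qed
  then show ?thesis using that hull injV by blast
qed

lemma affine_values_image:
  assumes inj: "inj_on F V"
    and rel: "\<And>l. affine_relation (F ` V) l \<longleftrightarrow> affine_relation V (l \<circ> F)"
  shows "affine_values (F ` V) g \<longleftrightarrow> affine_values V (g \<circ> F)"
proof
  assume g: "affine_values (F ` V) g"
  show "affine_values V (g \<circ> F)"
    unfolding affine_values_def
  proof (intro allI impI)
    fix l assume l: "affine_relation V l"
    define m where "m = l \<circ> inv_into V F"
    have m: "(m \<circ> F) v = l v" if "v \<in> V" for v
      using that inj by (simp add: m_def)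
    then have "affine_relation V (m \<circ> F)"
      using l by (simp add: affine_relation_def cong: sum.cong)
    then have "(\<Sum>y\<in>F ` V. m y * g y) = 0"
      using affine_valuesD[OF g] rel by blast
    then show "(\<Sum>v\<in>V. l v * (g \<circ> F) v) = 0"
      using m by (simp add: sum.reindex[OF inj] cong: sum.cong)
  qed
next
  assume g: "affine_values V (g \<circ> F)"
  show "affine_values (F ` V) g"
    unfolding affine_values_def
  proof (intro allI impI)
    fix l assume "affine_relation (F ` V) l"
    then have "affine_relation V (l \<circ> F)" using rel by blast
    from affine_valuesD[OF g this] show "(\<Sum>v\<in>F ` V. l v * g v) = 0"
      by (simp add: sum.reindex[OF inj])
  qed
qed

lemma has_small_cofaces_image:
  assumes V: "has_small_cofaces V" and inj: "inj_on F V"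
    and rel: "\<And>l. affine_relation (F ` V) l \<longleftrightarrow> affine_relation V (l \<circ> F)"
  shows "has_small_cofaces (F ` V)"
  unfolding has_small_cofaces_def
proof (intro conjI allI impI)
  have fin: "finite V" using V by (simp add: has_small_cofaces_def)
  then show "finite (F ` V)" by simp
  have supp: "supp (F ` V) g = F ` supp V (g \<circ> F)" for g
    by (auto simp: supp_def)
  fix g assume g: "affine_values (F ` V) g" "\<forall>x\<in>F ` V. 0 \<le> g x" "supp (F ` V) g \<noteq> {}"
  have "affine_values V (g \<circ> F)" "\<forall>x\<in>V. 0 \<le> (g \<circ> F) x" "supp V (g \<circ> F) \<noteq> {}"
    using affine_values_image[OF inj rel] g by (auto simp: supp)
  from has_small_cofacesD[OF V this]
  obtain h where h: "affine_values V h" "\<forall>x\<in>V. 0 \<le> h x" "supp V h \<noteq> {}"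
    "supp V h \<subseteq> supp V (g \<circ> F)" "card (supp V h) \<le> 2"
    by blast
  define h' where "h' = h \<circ> inv_into V F"
  have h': "(h' \<circ> F) v = h v" if "v \<in> V" for v
    using that inj by (simp add: h'_def)
  have "affine_values V (h' \<circ> F)"
    using h(1) affine_values_cong[of V "h' \<circ> F" h] h' by blast
  then have "affine_values (F ` V) h'"
    using affine_values_image[OF inj rel] by blast
  moreover have "supp V (h' \<circ> F) = supp V h" using h' by (auto simp: supp_def)
  then have "supp (F ` V) h' = F ` supp V h" by (simp add: supp)
  moreover have "card (F ` supp V h) \<le> 2"
    using card_image_le[of "supp V h" F] fin h(5) by (simp add: supp_def)
  moreover have "\<forall>x\<in>F ` V. 0 \<le> h' x" using h' h(2) by auto
  ultimately show "\<exists>h. affine_values (F ` V) h \<and> (\<forall>x\<in>F ` V. 0 \<le> h x) \<and> supp (F ` V) h \<noteq> {} \<and>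
            supp (F ` V) h \<subseteq> supp (F ` V) g \<and> card (supp (F ` V) h) \<le> 2"
    using h(3,4) by (intro exI[of _ h']) (simp add: supp image_mono)
qed

text \<open>Since relations split, a functional on one factor extends by zero to the union. It
  suffices to treat a factor on which \<open>g\<close> is not zero.\<close>

lemma has_small_cofaces_join:
  fixes V W :: "'a::euclidean_space set"
  assumes V: "has_small_cofaces V" and W: "has_small_cofaces W"
    and skew: "skew (affine hull V) (affine hull W)"
  shows "has_small_cofaces (V \<union> W)"
proof -
  have fin: "finite V" "finite W" using V W by (auto simp: has_small_cofaces_def)
  have sym: "skew (affine hull W) (affine hull V)"
    using skew unfolding skew_def by (metis inf_commute eq_iff_diff_eq_0)
  have extend: "\<exists>h. affine_values (V \<union> W) h \<and> (\<forall>x\<in>V \<union> W. 0 \<le> h x) \<and> supp (V \<union> W) h \<noteq> {} \<and>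
            supp (V \<union> W) h \<subseteq> supp (V \<union> W) g \<and> card (supp (V \<union> W) h) \<le> 2"
    if V: "has_small_cofaces V" and fin: "finite V" "finite W" and skew: "skew (affine hull V) (affine hull W)"
      and g: "affine_values (V \<union> W) g" "\<forall>x\<in>V \<union> W. 0 \<le> g x" "supp V g \<noteq> {}"
    for V W :: "'a set" and g
  proof -
    have disj: "V \<inter> W = {}" and rel: "\<And>l. affine_relation (V \<union> W) l \<Longrightarrow> affine_relation V l"
      using skew skew_affine_hull_iff[OF fin] by blast+
    have "affine_values V g" "\<forall>x\<in>V. 0 \<le> g x"
      using affine_values_subset[OF finite_UnI[OF fin] Un_upper1 g(1)] g(2) by auto
    from has_small_cofacesD[OF V this g(3)]
    obtain h where h: "affine_values V h" "\<forall>x\<in>V. 0 \<le> h x" "supp V h \<noteq> {}"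
      "supp V h \<subseteq> supp V g" "card (supp V h) \<le> 2"
      by blast
    define h' where "h' x = (if x \<in> V then h x else 0)" for x
    have "affine_values (V \<union> W) h'"
      unfolding affine_values_def
    proof (intro allI impI)
      fix l assume "affine_relation (V \<union> W) l"
      then have "(\<Sum>v\<in>V. l v * h v) = 0" using affine_valuesD[OF h(1)] rel by blast
      moreover have "(\<Sum>v\<in>V \<union> W. l v * h' v) = (\<Sum>v\<in>V. l v * h' v) + (\<Sum>v\<in>W. l v * h' v)"
        using fin disj by (intro sum.union_disjoint)
      moreover have "(\<Sum>v\<in>W. l v * h' v) = 0"
        using disj by (intro sum.neutral) (auto simp: h'_def)
      moreover have "(\<Sum>v\<in>V. l v * h' v) = (\<Sum>v\<in>V. l v * h v)"
        by (intro sum.cong) (auto simp: h'_def)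
      ultimately show "(\<Sum>v\<in>V \<union> W. l v * h' v) = 0" by simp
    qed
    moreover have "supp (V \<union> W) h' = supp V h" by (auto simp: supp_def h'_def)
    moreover have "supp V g \<subseteq> supp (V \<union> W) g" by (auto simp: supp_def)
    ultimately show ?thesis
      using h by (intro exI[of _ h']) (auto simp: h'_def)
  qed
  show ?thesis
    unfolding has_small_cofaces_def
  proof (intro conjI allI impI)
    show "finite (V \<union> W)" using fin by simp
    fix g assume g: "affine_values (V \<union> W) g" "\<forall>x\<in>V \<union> W. 0 \<le> g x" "supp (V \<union> W) g \<noteq> {}"
    then consider "supp V g \<noteq> {}" | "supp W g \<noteq> {}" by (auto simp: supp_def)
    then show "\<exists>h. affine_values (V \<union> W) h \<and> (\<forall>x\<in>V \<union> W. 0 \<le> h x) \<and> supp (V \<union> W) h \<noteq> {} \<and>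
            supp (V \<union> W) h \<subseteq> supp (V \<union> W) g \<and> card (supp (V \<union> W) h) \<le> 2"
    proof cases
      case 1
      then show ?thesis by (rule extend[OF V fin skew g(1,2)])
    next
      case 2
      then show ?thesis
        using extend[OF W fin(2,1) sym, of g] g(1,2) by (simp add: Un_commute)
    qed
  qed
qed

text \<open>The coordinates \<open>a\<close> and \<open>b\<close> of the origin give a relation,
  positive on \<open>A\<close> and negative on \<open>B\<close>, and all others are multiples of it.
  So a nonzero nonnegative functional is positive somewhere on both sides, and one point from each
  side carries a functional.\<close>

lemma has_small_cofaces_direct_sum:
  fixes A B :: "'a::euclidean_space set"
  assumes indA: "\<not> affine_dependent A" and indB: "\<not> affine_dependent B" and card: "2 \<le> card A"
    and span: "span A \<inter> span B = {0}"
    and int: "0 \<in> rel_interior (convex hull A)" "0 \<in> rel_interior (convex hull B)"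
  shows "has_small_cofaces (A \<union> B)"
proof -
  have fin: "finite A" "finite B" using indA indB aff_independent_finite by auto
  obtain a where a: "\<forall>x\<in>A. 0 < a x" "sum a A = 1" "(\<Sum>x\<in>A. a x *\<^sub>R x) = 0"
    using int(1) rel_interior_convex_hull_explicit[OF indA] by auto
  obtain b where b: "\<forall>x\<in>B. 0 < b x" "sum b B = 1" "(\<Sum>x\<in>B. b x *\<^sub>R x) = 0"
    using int(2) rel_interior_convex_hull_explicit[OF indB] by auto
  have unique: "m x = sum m X * c x"
    if ind: "\<not> affine_dependent X" and c: "sum c X = 1" "(\<Sum>x\<in>X. c x *\<^sub>R x) = 0"
      and m: "(\<Sum>x\<in>X. m x *\<^sub>R x) = 0" and x: "x \<in> X" for X :: "'a set" and m c x
  proof -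
    have "affine_relation X (\<lambda>y. m y - sum m X * c y)"
      using c m by (simp add: affine_relation_def sum_subtractf scaleR_left_diff_distrib
          flip: sum_distrib_left scaleR_scaleR scaleR_sum_right)
    then have "\<forall>y\<in>X. m y - sum m X * c y = 0"
      using ind affine_dependent_iff_relation[OF aff_independent_finite[OF ind]] by blast
    then show ?thesis using x by simp
  qed
  \<comment> \<open>A common point lies in both spans, so it is 0. But the origin, being in the
    relative interior of a simplex with at least two vertices, is not one of them.\<close>
  have disj: "A \<inter> B = {}"
  proof (rule ccontr)
    assume "A \<inter> B \<noteq> {}"
    then obtain x where "x \<in> A" "x \<in> B" by blast
    then have "x \<in> span A \<inter> span B" by (simp add: span_base)
    then have 0: "0 \<in> A" using span \<open>x \<in> A\<close> by auto
    have "\<not> A \<subseteq> {0}" using card card_mono[of "{0}" A] by auto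
    then obtain y where y: "y \<in> A" "y \<noteq> 0" by auto
    have "(\<Sum>x\<in>A. of_bool (x = 0) *\<^sub>R x) = 0"
      using fin 0 by (simp add: sum_of_bool_scaleR)
    from unique[OF indA a(2,3) this y(1)]
    have "of_bool (y = 0) = (\<Sum>x\<in>A. of_bool (x = 0)) * a y" .
    then show False using bspec[OF a(1) y(1)] y(2) 0 fin by (simp add: of_bool_def)
  qed
  show ?thesis
    unfolding has_small_cofaces_def
  proof (intro conjI allI impI)
    show "finite (A \<union> B)" using fin by simp
    fix g assume g: "affine_values (A \<union> B) g" "\<forall>x\<in>A \<union> B. 0 \<le> g x" "supp (A \<union> B) g \<noteq> {}"
    define l where "l x = (if x \<in> A then a x else - b x)" for x
    have sums: "(\<Sum>x\<in>A \<union> B. l x * k x) = (\<Sum>x\<in>A. a x * k x) - (\<Sum>x\<in>B. b x * k x)" for k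
    proof -
      have "(\<Sum>x\<in>B. l x * k x) = (\<Sum>x\<in>B. - (b x * k x))"
        using disj by (intro sum.cong) (auto simp: l_def)
      moreover have "(\<Sum>x\<in>A. l x * k x) = (\<Sum>x\<in>A. a x * k x)"
        by (intro sum.cong) (auto simp: l_def)
      ultimately show ?thesis
        using fin disj by (simp add: sum.union_disjoint sum_negf)
    qed
    have "(\<Sum>x\<in>A. l x *\<^sub>R x) = 0"
      using a(3) by (simp add: l_def cong: sum.cong)
    moreover have "(\<Sum>x\<in>B. l x *\<^sub>R x) = (\<Sum>x\<in>B. - (b x *\<^sub>R x))"
      using disj by (intro sum.cong) (auto simp: l_def)
    ultimately have "(\<Sum>x\<in>A \<union> B. l x *\<^sub>R x) = 0"
      using b(3) fin disj by (simp add: sum.union_disjoint sum_negf)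
    then have "affine_relation (A \<union> B) l"
      using sums[of "\<lambda>_. 1"] a(2) b(2) by (simp add: affine_relation_def)
    then have eq: "(\<Sum>x\<in>A. a x * g x) = (\<Sum>x\<in>B. b x * g x)"
      using affine_valuesD[OF g(1)] sums by force
    have pos: "(\<Sum>x\<in>X. c x * g x) = 0 \<longleftrightarrow> supp X g = {}"
      if X: "\<forall>x\<in>X. 0 < c x" "X \<subseteq> A \<union> B" "finite X" for X c
    proof -
      have c: "0 < c x" "0 \<le> g x" if "x \<in> X" for x using X g(2) that by auto
      then have "(\<Sum>x\<in>X. c x * g x) = 0 \<longleftrightarrow> (\<forall>x\<in>X. c x * g x = 0)"
        by (intro sum_nonneg_eq_0_iff X(3)) (simp add: less_imp_le)
      then show ?thesis using c by (force simp: supp_def)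
    qed
    have "supp A g \<noteq> {} \<and> supp B g \<noteq> {}"
      using pos[OF a(1)] pos[OF b(1)] fin eq g(3) by (auto simp: supp_def)
    then obtain u v where u: "u \<in> A" "g u \<noteq> 0" and v: "v \<in> B" "g v \<noteq> 0"
      by (auto simp: supp_def)
    have uv: "u \<noteq> v" using u v disj by auto
    \<comment> \<open>The weights are reciprocal to the coordinates of the origin, so the
      contributions at \<open>u\<close> and \<open>v\<close> cancel in every relation.\<close>
    define h where "h x = of_bool (x = u) / a u + of_bool (x = v) / b v" for x
    have "affine_values (A \<union> B) h"
      unfolding affine_values_def
    proof (intro allI impI)
      fix m assume m: "affine_relation (A \<union> B) m"
      let ?x = "\<Sum>x\<in>A. m x *\<^sub>R x" and ?y = "\<Sum>x\<in>B. m x *\<^sub>R x"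
      have s: "sum m B = - sum m A" and yx: "?y = - ?x"
        using m fin disj by (simp_all add: affine_relation_def sum.union_disjoint add_eq_0_iff)
      have "?x \<in> span A" "?y \<in> span B"
        by (intro span_sum span_scale span_base; assumption)+
      moreover have "?x = - ?y" by (simp add: yx)
      ultimately have "?x \<in> span A \<inter> span B"
        using span_neg by (metis IntI)
      then have x0: "?x = 0" using span by auto
      then have y0: "?y = 0" using yx by simp
      have "m u = sum m A * a u" by (rule unique[OF indA a(2,3) x0 u(1)])
      moreover have "m v = - sum m A * b v"
        using unique[OF indB b(2,3) y0 v(1)] s by simp
      moreover have "a u \<noteq> 0" "b v \<noteq> 0" using a(1) b(1) u v by auto
      moreover have "(\<Sum>x\<in>A \<union> B. m x * h x) = (\<Sum>x\<in>A \<union> B. (if x = u then m x / a u else 0) + (if x = v then m x / b v else 0))"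
        by (intro sum.cong) (auto simp: h_def distrib_left)
      ultimately show "(\<Sum>x\<in>A \<union> B. m x * h x) = 0"
        using fin u v by (simp add: sum.distrib)
    qed
    moreover have "supp (A \<union> B) h = {u, v}"
      using u v uv a(1) b(1) by (auto simp: supp_def h_def)
    moreover have "0 \<le> h x" for x
      using a(1) b(1) u v by (auto simp: h_def less_imp_le)
    ultimately show "\<exists>h. affine_values (A \<union> B) h \<and> (\<forall>x\<in>A \<union> B. 0 \<le> h x) \<and> supp (A \<union> B) h \<noteq> {} \<and>
            supp (A \<union> B) h \<subseteq> supp (A \<union> B) g \<and> card (supp (A \<union> B) h) \<le> 2"
      using u v uv by (intro exI[of _ h]) (auto simp: supp_def)
  qed
qed

text \<open>Generating points are carried through the construction; passing to an affine copy
  preserves their relations.\<close>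

lemma simplex_sum_join_has_small_cofaces:
  assumes "simplex_sum_join n jks Q" "\<forall>(j, k)\<in>set jks. 1 \<le> j \<and> 1 \<le> k"
  shows "\<exists>V. has_small_cofaces V \<and> Q = convex hull V"
  using assms
proof (induction rule: simplex_sum_join.induct)
  case (simplex n S)
  then show ?case
    unfolding simplex_def using has_small_cofaces_simplex by blast
next
  case (join n jks Q j A k B S R)
  then obtain V where V: "has_small_cofaces V" "Q = convex hull V" by auto
  have j: "1 \<le> j" using join.prems by simp
  obtain A0 where A0: "\<not> affine_dependent A0" "int (card A0) = int j + 1" "A = convex hull A0"
    using join.hyps(2) by (auto simp: simplex_def)
  obtain B0 where B0: "\<not> affine_dependent B0" "B = convex hull B0"
    using join.hyps(3) by (auto simp: simplex_def)
  have fin: "finite A0" "finite B0" "finite V"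
    using A0 B0 V aff_independent_finite by (auto simp: has_small_cofaces_def)
  obtain A' B' where AB: "affine_copy A A'" "affine_copy B B'"
    "span A' \<inter> span B' = {0}" "0 \<in> rel_interior A'" "0 \<in> rel_interior B'"
    "S = convex hull (A' \<union> B')"
    using join.hyps(4) unfolding is_direct_sum_def by blast
  obtain F where F: "A' = convex hull (F ` A0)" "inj_on F A0"
    "\<And>l. affine_relation (F ` A0) l \<longleftrightarrow> affine_relation A0 (l \<circ> F)"
    using affine_copy_convex_hull[OF fin(1)] AB(1) A0(3) by metis
  obtain G where G: "B' = convex hull (G ` B0)" "inj_on G B0"
    "\<And>l. affine_relation (G ` B0) l \<longleftrightarrow> affine_relation B0 (l \<circ> G)"
    using affine_copy_convex_hull[OF fin(2)] AB(2) B0(2) by metis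
  have ind: "\<not> affine_dependent (F ` A0)" "\<not> affine_dependent (G ` B0)"
    using A0(1) B0(1) F(3) G(3) fin by (auto simp: affine_dependent_iff_relation)
  have "span (F ` A0) \<inter> span (G ` B0) = {0}"
  proof -
    have "span (F ` A0) \<subseteq> span A'" "span (G ` B0) \<subseteq> span B'"
      unfolding F(1) G(1) by (intro span_mono hull_subset)+
    then show ?thesis using AB(3) span_zero by blast
  qed
  moreover have "card (F ` A0) \<ge> 2" using A0(2) j F(2) by (simp add: card_image)
  ultimately have "has_small_cofaces (F ` A0 \<union> G ` B0)"
    using has_small_cofaces_direct_sum[OF ind] AB(4,5) F(1) G(1) by simp
  moreover have "S = convex hull (F ` A0 \<union> G ` B0)"
    unfolding AB(6) F(1) G(1) by (rule hull_Un[symmetric]) (simp add: convex_Inter)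
  ultimately obtain W where W: "has_small_cofaces W" "S = convex hull W" by blast
  obtain Q' S' where QS: "affine_copy Q Q'" "affine_copy S S'"
    "skew (affine hull Q') (affine hull S')" "R = convex hull (Q' \<union> S')"
    using join.hyps(5) unfolding is_join_def by blast
  have finW: "finite W" using W by (simp add: has_small_cofaces_def)
  obtain F' where F': "Q' = convex hull (F' ` V)" "inj_on F' V"
    "\<And>l. affine_relation (F' ` V) l \<longleftrightarrow> affine_relation V (l \<circ> F')"
    using affine_copy_convex_hull[OF fin(3)] QS(1) V(2) by metis
  obtain G' where G': "S' = convex hull (G' ` W)" "inj_on G' W"
    "\<And>l. affine_relation (G' ` W) l \<longleftrightarrow> affine_relation W (l \<circ> G')"
    using affine_copy_convex_hull[OF finW] QS(2) W(2) by metis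
  have "has_small_cofaces (F' ` V \<union> G' ` W)"
    using QS(3) F' G'
    by (intro has_small_cofaces_join has_small_cofaces_image V(1) W(1)) simp_all
  moreover have "R = convex hull (F' ` V \<union> G' ` W)"
    unfolding QS(4) F'(1) G'(1) by (rule hull_Un[symmetric]) (simp add: convex_Inter)
  ultimately show ?case by blast
qed

subsection \<open>Faces of polytopes\<close>

lemma polytope_vertices:
  assumes "polytope P"
  shows "finite (vertices P)" "P = convex hull (vertices P)"
proof -
  obtain S where S: "finite S" "P = convex hull S"
    using assms by (auto simp: polytope_def)
  show "finite (vertices P)"
    using extreme_points_of_convex_hull[of S] finite_subset S by (auto simp: vertices_def)
  show "P = convex hull (vertices P)"
    unfolding vertices_def
    using Krein_Milman_Minkowski polytope_imp_compact[OF assms] polytope_imp_convex[OF assms] by blast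
qed

lemma vertices_face: "F face_of P \<Longrightarrow> vertices F = vertices P \<inter> F"
  using extreme_point_of_face by (auto simp: vertices_def)

lemma vertices_simplex: "\<not> affine_dependent C \<Longrightarrow> vertices (convex hull C) = C"
  by (simp add: vertices_def extreme_point_of_convex_hull_affine_independent)

text \<open>Every face of a polytope is exposed; the slack of the supporting inequality is the
  functional.\<close>

lemma face_affine_values:
  fixes V :: "'a::euclidean_space set"
  assumes "finite V" "F face_of (convex hull V)"
  obtains g where "affine_values V g" "\<And>x. x \<in> V \<Longrightarrow> 0 \<le> g x" "\<And>x. x \<in> V \<Longrightarrow> g x = 0 \<longleftrightarrow> x \<in> F"
proof -
  have "polyhedron (convex hull V)"
    using assms(1) polytope_convex_hull polytope_imp_polyhedron by blast
  then have "F exposed_face_of (convex hull V)"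
    using assms(2) exposed_face_of_polyhedron by blast
  then obtain a b where ab: "convex hull V \<subseteq> {x. a \<bullet> x \<le> b}" "F = convex hull V \<inter> {x. a \<bullet> x = b}"
    by (auto simp: exposed_face_of_def)
  have V: "x \<in> convex hull V" if "x \<in> V" for x
    using that by (simp add: hull_inc)
  show ?thesis
  proof
    show "affine_values V (\<lambda>x. (- a) \<bullet> x + b)" by (rule affine_values_inner)
    show "0 \<le> (- a) \<bullet> x + b" if "x \<in> V" for x
      using subsetD[OF ab(1) V[OF that]] by simp
    show "(- a) \<bullet> x + b = 0 \<longleftrightarrow> x \<in> F" if "x \<in> V" for x
      using V[OF that] by (auto simp: ab(2))
  qed
qed

lemma affine_values_face:
  fixes V :: "'a::euclidean_space set"
  assumes "finite V" "affine_values V g" "\<And>x. x \<in> V \<Longrightarrow> 0 \<le> g x"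
  obtains F where "F face_of (convex hull V)" "\<And>x. x \<in> V \<Longrightarrow> x \<in> F \<longleftrightarrow> g x = 0"
proof -
  obtain w c where wc: "\<And>x. x \<in> V \<Longrightarrow> g x = w \<bullet> x + c"
    using affine_values_iff[OF assms(1)] assms(2) by blast
  have "V \<subseteq> {x. - c \<le> w \<bullet> x}"
    using assms(3) wc by force
  then have "convex hull V \<subseteq> {x. - c \<le> w \<bullet> x}"
    using hull_minimal convex_halfspace_ge[of "- c" w] by (metis (mono_tags, lifting))
  then have "convex hull V \<inter> {x. w \<bullet> x = - c} face_of (convex hull V)"
    by (intro face_of_Int_supporting_hyperplane_ge) auto
  then show ?thesis
    using that[of "convex hull V \<inter> {x. w \<bullet> x = - c}"] wc by (auto simp: hull_inc add_eq_0_iff2)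
qed

lemma face_eq_convex_hull:
  fixes V :: "'a::euclidean_space set"
  assumes "finite V" "F face_of (convex hull V)"
  shows "F = convex hull (V \<inter> F)"
proof
  obtain T where T: "T \<subseteq> V" "F = convex hull T"
    using face_of_convex_hull_subset[OF finite_imp_compact[OF assms(1)] assms(2)] by blast
  then have "T \<subseteq> V \<inter> F" by (auto simp: hull_inc)
  then show "F \<subseteq> convex hull (V \<inter> F)"
    unfolding T(2) by (rule hull_mono)
  show "convex hull (V \<inter> F) \<subseteq> F"
    using face_of_imp_convex[OF assms(2)] by (simp add: hull_minimal)
qed

text \<open>A functional with small support inside that of \<open>G\<close> exposes a proper face
  containing \<open>G\<close>, which is \<open>G\<close> by maximality. Maximality, unlike
  dimension, is visible in the face lattice directly.\<close>

lemma card_maximal_coface_le: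
  fixes V :: "'a::euclidean_space set"
  assumes V: "has_small_cofaces V" and G: "G face_of (convex hull V)" "G \<noteq> convex hull V"
    and max: "\<And>H. H face_of (convex hull V) \<Longrightarrow> G \<subseteq> H \<Longrightarrow> H \<noteq> convex hull V \<Longrightarrow> H = G"
  shows "card (V - G) \<le> 2"
proof -
  have fin: "finite V" using V by (simp add: has_small_cofaces_def)
  obtain g where g: "affine_values V g" "\<And>x. x \<in> V \<Longrightarrow> 0 \<le> g x" "\<And>x. x \<in> V \<Longrightarrow> g x = 0 \<longleftrightarrow> x \<in> G"
    by (rule face_affine_values[OF fin G(1)]) (rule that)
  have supp_g: "supp V g = V - G" using g(3) by (auto simp: supp_def)
  have "\<not> V \<subseteq> G"
    using G face_of_imp_convex face_of_imp_subset hull_minimal by (metis subset_antisym)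
  then have "supp V g \<noteq> {}" by (auto simp: supp_g)
  moreover have "\<forall>x\<in>V. 0 \<le> g x" using g(2) by blast
  ultimately obtain h where h: "affine_values V h" "\<forall>x\<in>V. 0 \<le> h x" "supp V h \<noteq> {}"
      "supp V h \<subseteq> supp V g" "card (supp V h) \<le> 2"
    using has_small_cofacesD[OF V g(1)] by blast
  obtain H where H: "H face_of (convex hull V)" "\<And>x. x \<in> V \<Longrightarrow> x \<in> H \<longleftrightarrow> h x = 0"
    using affine_values_face[OF fin h(1)] h(2) by blast
  have supp_h: "supp V h = V - H" using H(2) by (auto simp: supp_def)
  have "V \<inter> G \<subseteq> V \<inter> H" using h(4) unfolding supp_g supp_h by blast
  then have "G \<subseteq> H"
    using face_eq_convex_hull[OF fin G(1)] face_eq_convex_hull[OF fin H(1)] hull_mono by metis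
  moreover have "H \<noteq> convex hull V"
    using h(3) unfolding supp_h by (auto simp: hull_inc)
  ultimately have "H = G" using max H(1) by blast
  then show ?thesis using h(5) supp_h by simp
qed

text \<open>A nonempty proper face is the intersection of the facets containing it, so a vertex off
  the face is off one of these facets.\<close>

lemma small_cofacets_vertices:
  fixes P :: "'a::euclidean_space set"
  assumes P: "polytope P"
    and facets: "\<And>F. F facet_of P \<Longrightarrow> card (vertices P - vertices F) \<le> 2"
  shows "small_cofacets (vertices P)"
proof
  let ?V = "vertices P"
  note fin = polytope_vertices(1)[OF P] and PV = polytope_vertices(2)[OF P]
  show "finite ?V" by (rule fin)
  have vertex_face: "{u} face_of P" if "u \<in> ?V" for u
    using that by (simp add: vertices_def face_of_singleton)
  have functional: "\<exists>g. affine_values ?V g \<and> (\<forall>x\<in>?V. 0 \<le> g x) \<and> (\<forall>x\<in>?V. g x = 0 \<longleftrightarrow> x \<in> F)"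
    if "F face_of P" for F
    using face_affine_values[OF fin, of F] that PV by metis
  show "\<exists>g. affine_values ?V g \<and> (\<forall>x\<in>?V. 0 \<le> g x) \<and> (\<forall>x\<in>?V. g x = 0 \<longleftrightarrow> x = u)" if "u \<in> ?V" for u
    using functional[OF vertex_face[OF that]] by simp
  fix g v
  assume g: "affine_values ?V g" "\<And>x. x \<in> ?V \<Longrightarrow> 0 \<le> g x" and v: "v \<in> ?V" "0 < g v"
  show "\<exists>h. affine_values ?V h \<and> (\<forall>x\<in>?V. 0 \<le> h x) \<and> 0 < h v \<and> supp ?V h \<subseteq> supp ?V g \<and> card (supp ?V h) \<le> 2"
  \<comment> \<open>A single point has no facets; there the constant 1 has a support of one
    point.\<close>
  proof (cases "?V = {v}")
    case True
    then show ?thesis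
      using v by (intro exI[of _ "\<lambda>_. 1"]) (simp add: affine_values_const supp_def)
  next
    case False
    obtain G where G: "G face_of P" "\<And>x. x \<in> ?V \<Longrightarrow> x \<in> G \<longleftrightarrow> g x = 0"
      using affine_values_face[OF fin g] PV by metis
    obtain u where u: "u \<in> ?V" "u \<noteq> v" using False v by blast
    \<comment> \<open>The intersection of facets requires a nonempty face, so a vertex other than
      \<open>v\<close> replaces the empty one.\<close>
    define G' where "G' = (if G = {} then {u} else G)"
    have G': "G' face_of P" "G' \<noteq> {}" "G \<subseteq> G'" "v \<notin> G'"
      using G v u vertex_face by (auto simp: G'_def)
    moreover have "v \<in> P" using v(1) by (simp add: vertices_def extreme_point_of_def)
    ultimately have "G' = \<Inter>{F. F facet_of P \<and> G' \<subseteq> F}"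
      using face_of_polyhedron[OF polytope_imp_polyhedron[OF P]] by blast
    then obtain F where F: "F facet_of P" "G' \<subseteq> F" "v \<notin> F"
      using G'(4) by blast
    have FP: "F face_of P" using F(1) by (simp add: facet_of_def)
    obtain h where h: "affine_values ?V h" "\<forall>x\<in>?V. 0 \<le> h x" "\<forall>x\<in>?V. h x = 0 \<longleftrightarrow> x \<in> F"
      using functional[OF FP] by blast
    have supp_h: "supp ?V h = ?V - F" using h(3) by (auto simp: supp_def)
    have "supp ?V h \<subseteq> supp ?V g"
      using G(2) G'(3) F(2) unfolding supp_h by (auto simp: supp_def)
    moreover have "?V - F = ?V - vertices F" using vertices_face[OF FP] by auto
    then have "card (supp ?V h) \<le> 2" using facets[OF F(1)] by (simp add: supp_h)
    moreover have "0 < h v" using h(2,3) v(1) F(3) by (metis less_eq_real_def)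
    ultimately show ?thesis using h by blast
  qed
qed

section \<open>Facets under combinatorial equivalence\<close>

lemma facet_of_maximal:
  assumes "convex P" "F facet_of P" "G face_of P" "F \<subseteq> G" "G \<noteq> P"
  shows "G = F"
proof (rule ccontr)
  assume "G \<noteq> F"
  have "F face_of G"
    using assms face_of_subset face_of_imp_subset unfolding facet_of_def by blast
  then have "aff_dim F < aff_dim G"
    using \<open>G \<noteq> F\<close> assms(3) face_of_aff_dim_lt face_of_imp_convex by blast
  moreover have "aff_dim G < aff_dim P"
    using assms face_of_aff_dim_lt by blast
  ultimately show False using assms(2) by (simp add: facet_of_def)
qed

text \<open>The isomorphism sends \<open>F\<close> to a maximal proper face, which misses at most
  two points of \<open>W\<close>. It sends vertices to distinct points of \<open>W\<close>, and
  those missed by \<open>F\<close> to points missed by the image.\<close>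

lemma facets_of_combinatorially_equivalent:
  fixes P :: "'a::euclidean_space set" and W :: "'b::euclidean_space set"
  assumes P: "polytope P" and W: "has_small_cofaces W"
    and equiv: "combinatorially_equivalent P (convex hull W)" and F: "F facet_of P"
  shows "card (vertices P - vertices F) \<le> 2"
proof -
  let ?Q = "convex hull W"
  obtain \<phi> where bij: "bij_betw \<phi> {F. F face_of P} {G. G face_of ?Q}"
    and mono: "\<And>F F'. F face_of P \<Longrightarrow> F' face_of P \<Longrightarrow> F \<subseteq> F' \<longleftrightarrow> \<phi> F \<subseteq> \<phi> F'"
    using equiv unfolding combinatorially_equivalent_def by blast
  have finW: "finite W" using W by (simp add: has_small_cofaces_def)
  have convP: "convex P" by (rule polytope_imp_convex[OF P])
  have PP: "P face_of P" by (rule face_of_refl[OF convP])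
  have QQ: "?Q face_of ?Q" by (simp add: face_of_refl)
  have img: "\<phi> H face_of ?Q" if "H face_of P" for H
    using bij_betwE[OF bij] that by blast
  have pre: "\<exists>H. H face_of P \<and> \<phi> H = G" if "G face_of ?Q" for G
  proof -
    have "G \<in> \<phi> ` {F. F face_of P}" using bij_betw_imp_surj_on[OF bij] that by simp
    then show ?thesis by auto
  qed
  have inj: "H = H'" if "H face_of P" "H' face_of P" "\<phi> H = \<phi> H'" for H H'
    using mono[OF that(1,2)] mono[OF that(2,1)] that(3) by (intro subset_antisym) simp_all
  have FP: "F face_of P" and FneP: "F \<noteq> P" using F by (auto simp: facet_of_def)
  have top: "\<phi> P = ?Q"
  proof -
    obtain H where H: "H face_of P" "\<phi> H = ?Q" using pre[OF QQ] by blast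
    then have "?Q \<subseteq> \<phi> P" using mono[OF H(1) PP] face_of_imp_subset by blast
    then show ?thesis using face_of_imp_subset[OF img[OF PP]] by blast
  qed
  have bot: "\<phi> {} = {}"
  proof -
    obtain H where H: "H face_of P" "\<phi> H = {}" using pre[of "{}"] by auto
    then show ?thesis using mono[of "{}" H] by auto
  qed
  \<comment> \<open>The image of \<open>{v}\<close> has a vertex \<open>q\<close>, and the preimage
    of \<open>{q}\<close> is a nonempty face inside \<open>{v}\<close>.\<close>
  have "\<exists>q\<in>W. \<phi> {v} = {q}" if v: "v \<in> vertices P" for v
  proof -
    have vP: "{v} face_of P" using v by (simp add: vertices_def face_of_singleton)
    let ?G = "\<phi> {v}"
    have "?G \<noteq> {}" using inj[OF vP, of "{}"] bot by auto
    moreover have polyG: "polytope ?G"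
      using face_of_polytope_polytope[OF polytope_convex_hull[OF finW] img[OF vP]] .
    ultimately obtain q where q: "q \<in> vertices ?G"
      using polytope_vertices(2)[OF polyG] by fastforce
    then have qQ: "q \<in> vertices ?Q" "q \<in> ?G" using vertices_face[OF img[OF vP]] by auto
    then have qW: "q \<in> W" and qF: "{q} face_of ?Q"
      using extreme_point_of_convex_hull by (auto simp: vertices_def face_of_singleton)
    obtain H where H: "H face_of P" "\<phi> H = {q}" using pre[OF qF] by blast
    then have "H \<subseteq> {v}" using mono[OF H(1) vP] qQ by simp
    moreover have "H \<noteq> {}" using H(2) bot by auto
    ultimately show ?thesis using H qW by (metis subset_singletonD)
  qed
  then obtain f where f: "\<And>v. v \<in> vertices P \<Longrightarrow> f v \<in> W \<and> \<phi> {v} = {f v}" by metis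
  have vP: "{v} face_of P" if "v \<in> vertices P" for v
    using that by (simp add: vertices_def face_of_singleton)
  have "\<phi> F \<noteq> ?Q" using inj[OF FP PP] top FneP by auto
  moreover have "H = \<phi> F" if H: "H face_of ?Q" "\<phi> F \<subseteq> H" "H \<noteq> ?Q" for H
  proof -
    obtain F' where F': "F' face_of P" "\<phi> F' = H" using pre[OF H(1)] by blast
    then have "F \<subseteq> F'" "F' \<noteq> P" using mono[OF FP F'(1)] H top by auto
    then show ?thesis using facet_of_maximal[OF convP F F'(1)] F'(2) by simp
  qed
  ultimately have "card (W - \<phi> F) \<le> 2"
    using card_maximal_coface_le[OF W img[OF FP]] by blast
  moreover have "card (vertices P - vertices F) \<le> card (W - \<phi> F)"
  proof (rule card_inj_on_le)
    show "inj_on f (vertices P - vertices F)"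
    proof (rule inj_onI)
      fix x y assume "x \<in> vertices P - vertices F" "y \<in> vertices P - vertices F" "f x = f y"
      then show "x = y" using inj[of "{x}" "{y}"] vP f by auto
    qed
    show "f ` (vertices P - vertices F) \<subseteq> W - \<phi> F"
    proof
      fix q assume "q \<in> f ` (vertices P - vertices F)"
      then obtain v where v: "v \<in> vertices P" "v \<notin> F" "q = f v"
        using vertices_face[OF FP] by auto
      have "\<not> \<phi> {v} \<subseteq> \<phi> F" using mono[OF vP[OF v(1)] FP] v(2) by simp
      then show "q \<in> W - \<phi> F" using f[OF v(1)] v(3) by simp
    qed
    show "finite (W - \<phi> F)" using finW by simp
  qed
  ultimately show ?thesis by simp
qed

section \<open>Existence of large simplex faces\<close>

lemma simplex_face_pyramid:
  fixes P :: "'a::euclidean_space set"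
  assumes P: "polytope P" and F: "F face_of P" and p: "vertices P - F = {p}"
    and G: "G face_of F" "e simplex G"
  shows "\<exists>H. H face_of P \<and> (e + 1) simplex H"
proof -
  let ?V = "vertices P"
  note fin = polytope_vertices(1)[OF P] and PV = polytope_vertices(2)[OF P]
  obtain C where C: "\<not> affine_dependent C" "int (card C) = e + 1" "G = convex hull C"
    using G(2) by (auto simp: simplex_def)
  have GP: "G face_of P" by (rule face_of_trans[OF G(1) F])
  have VG: "?V \<inter> G = C"
    using vertices_face[OF GP] vertices_simplex[OF C(1)] C(3) by simp
  have GF: "G \<subseteq> F" by (rule face_of_imp_subset[OF G(1)])
  have pV: "p \<in> ?V" "p \<notin> F" using p by auto
  obtain f where f: "affine_values ?V f" "\<And>x. x \<in> ?V \<Longrightarrow> 0 \<le> f x" "\<And>x. x \<in> ?V \<Longrightarrow> f x = 0 \<longleftrightarrow> x \<in> F"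
    using face_affine_values[OF fin] F PV by metis
  obtain g where g: "affine_values ?V g" "\<And>x. x \<in> ?V \<Longrightarrow> 0 \<le> g x" "\<And>x. x \<in> ?V \<Longrightarrow> g x = 0 \<longleftrightarrow> x \<in> G"
    using face_affine_values[OF fin] GP PV by metis
  have fp: "f p \<noteq> 0" using f(3) pV by blast
  \<comment> \<open>The functional of \<open>F\<close> is nonzero only at \<open>p\<close>.
    Subtracting this multiple of it makes the value at \<open>p\<close> zero and changes nothing
    else, so the face exposed by \<open>g\<close> gains exactly the vertex \<open>p\<close>.\<close>
  define h where "h x = g x - (g p / f p) * f x" for x
  have h: "affine_values ?V h"
    unfolding h_def by (intro affine_values_diff affine_values_scale f g)
  have hp: "h p = 0" using fp by (simp add: h_def)
  have hF: "h x = g x" if "x \<in> ?V" "x \<noteq> p" for x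
  proof -
    have "x \<in> F" using that p by blast
    then show ?thesis using f(3) that by (simp add: h_def)
  qed
  have "0 \<le> h x" if "x \<in> ?V" for x
    using hF[OF that] hp g(2)[OF that] by (cases "x = p") auto
  then obtain H where H: "H face_of P" "\<And>x. x \<in> ?V \<Longrightarrow> x \<in> H \<longleftrightarrow> h x = 0"
    using affine_values_face[OF fin h] PV by metis
  have VH: "?V \<inter> H = insert p C"
  proof (intro equalityI subsetI)
    fix x assume "x \<in> ?V \<inter> H"
    then show "x \<in> insert p C"
      using H(2) hF g(3) VG by (metis Int_iff insertCI)
  next
    fix x assume "x \<in> insert p C"
    then have "x \<in> ?V" "x = p \<or> x \<in> G" using pV(1) VG by auto
    then show "x \<in> ?V \<inter> H"
      using H(2) hF hp g(3) by (metis IntI)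
  qed
  obtain w c where wc: "\<And>x. x \<in> ?V \<Longrightarrow> f x = w \<bullet> x + c"
    using affine_values_iff[OF fin] f(1) by blast
  have "C \<subseteq> {x. w \<bullet> x = - c}"
  proof
    fix x assume "x \<in> C"
    then have "x \<in> ?V" "x \<in> F" using VG GF by auto
    then show "x \<in> {x. w \<bullet> x = - c}" using f(3) wc by (simp add: add_eq_0_iff2)
  qed
  then have "affine hull C \<subseteq> {x. w \<bullet> x = - c}"
    using affine_hyperplane hull_minimal by metis
  moreover have "w \<bullet> p \<noteq> - c" using fp wc[OF pV(1)] by simp
  ultimately have "p \<notin> affine hull C" by blast
  then have ind: "\<not> affine_dependent (insert p C)" and "p \<notin> C"
    using affine_independent_insert[OF C(1)] hull_inc by metis+
  then have "int (card (insert p C)) = (e + 1) + 1"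
    using C(2) aff_independent_finite[OF C(1)] by simp
  then have "(e + 1) simplex (convex hull (insert p C))"
    using ind by (intro simplex_convex_hull) simp
  moreover have "H = convex hull (insert p C)"
    using face_eq_convex_hull[OF fin] H(1) PV VH by metis
  ultimately show ?thesis using H(1) by blast
qed

text \<open>Passing to a facet lowers \<open>2 * aff_dim P\<close> by 2. If the facet misses at
  least two vertices, the bound carries over; if it misses one, the pyramid over the simplex makes
  up for the difference of 1.\<close>

lemma simplex_face_exists:
  fixes P :: "'a::euclidean_space set"
  assumes "polytope P"
  shows "\<exists>F e. F face_of P \<and> e simplex F \<and> 2 * aff_dim P + 1 - int (card (vertices P)) \<le> e"
  using assms
proof (induction "nat (aff_dim P + 1)" arbitrary: P rule: less_induct)
  case less
  let ?V = "vertices P"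
  note fin = polytope_vertices(1)[OF less.prems] and PV = polytope_vertices(2)[OF less.prems]
  consider "P = {}" | a where "P = {a}" | "0 < aff_dim P"
    using aff_dim_geq[of P] aff_dim_eq_0[of P] aff_dim_empty[of P] by force
  then show ?case
  proof cases
    case 1
    \<comment> \<open>The empty polytope has dimension -1 and is a simplex of that dimension, so the
      bound is attained.\<close>
    then show ?thesis by (intro exI[of _ "{}"] exI[of _ "- 1"]) (simp add: vertices_def)
  next
    case (2 a)
    then show ?thesis
      by (intro exI[of _ "{a}"] exI[of _ 0]) (simp add: vertices_def face_of_refl)
  next
    case 3
    obtain F where F: "F facet_of P" using polytope_facet_exists[OF less.prems 3] by blast
    have FP: "F face_of P" and FneP: "F \<noteq> P" and dimF: "aff_dim F = aff_dim P - 1"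
      using F by (auto simp: facet_of_def)
    have "nat (aff_dim F + 1) < nat (aff_dim P + 1)" using 3 dimF by simp
    then obtain G e where G: "G face_of F" "e simplex G" "2 * aff_dim F + 1 - int (card (vertices F)) \<le> e"
      using less.hyps face_of_polytope_polytope[OF less.prems FP] by blast
    have "card (?V \<inter> F) + card (?V - F) = card ?V"
      using fin by (metis card_Int_Diff)
    then have card: "card (vertices F) + card (?V - F) = card ?V"
      using vertices_face[OF FP] by simp
    have "\<not> ?V \<subseteq> F"
      using FP FneP PV face_of_imp_convex face_of_imp_subset hull_minimal by (metis subset_antisym)
    then have "card (?V - F) \<noteq> 0" using fin by auto
    then consider "card (?V - F) = 1" | "2 \<le> card (?V - F)" by linarith
    then show ?thesis
    proof cases
      case 1
      then obtain p where "?V - F = {p}" by (auto simp: card_1_singleton_iff)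
      then obtain H where "H face_of P" "(e + 1) simplex H"
        using simplex_face_pyramid[OF less.prems FP _ G(1,2)] by blast
      moreover have "2 * aff_dim P + 1 - int (card ?V) \<le> e + 1"
        using G(3) dimF card 1 by simp
      ultimately show ?thesis by blast
    next
      case 2
      then have "2 * aff_dim P + 1 - int (card ?V) \<le> e"
        using G(3) dimF card by simp
      then show ?thesis using face_of_trans[OF G(1) FP] G(2) by blast
    qed
  qed
qed

lemma simplex_face_lower_dim:
  assumes "e simplex F" "- 1 \<le> k" "k \<le> e"
  shows "\<exists>G. G face_of F \<and> k simplex G"
proof -
  obtain C where C: "\<not> affine_dependent C" "int (card C) = e + 1" "F = convex hull C"
    using assms(1) by (auto simp: simplex_def)
  have "nat (k + 1) \<le> card C" using assms C(2) by simp
  then obtain D where D: "D \<subseteq> C" "card D = nat (k + 1)"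
    using obtain_subset_with_card_n by metis
  have "convex hull D face_of F"
    using face_of_convex_hull_affine_independent[OF C(1)] D(1) C(3) by blast
  moreover have "k simplex (convex hull D)"
    using affine_independent_subset[OF C(1) D(1)] D(2) assms(2) by (intro simplex_convex_hull) simp
  ultimately show ?thesis by blast
qed

section \<open>Equivalence of the three conditions\<close>

lemma combinatorially_equivalent_refl: "combinatorially_equivalent P P"
  unfolding combinatorially_equivalent_def by (intro exI[of _ id]) auto

theorem theorem3p9:
  fixes P :: "'a::euclidean_space set" and d \<gamma> :: nat
  assumes "\<gamma> \<le> d"
    and "polytope P"
    and "aff_dim P = int d"
    and "card (vertices P) = d + \<gamma> + 1"
  shows "((\<forall>F. F facet_of P \<longrightarrow> card (vertices P - vertices F) \<le> 2)
            \<longleftrightarrow> (\<exists>n jks. (\<forall>(j, k)\<in>set jks. 1 \<le> j \<and> 1 \<le> k) \<and>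
                  (\<exists>Q :: 'a set. simplex_sum_join n jks Q \<and> combinatorially_equivalent P Q)))
       \<and> ((\<exists>n jks. (\<forall>(j, k)\<in>set jks. 1 \<le> j \<and> 1 \<le> k) \<and>
                  (\<exists>Q :: 'a set. simplex_sum_join n jks Q \<and> combinatorially_equivalent P Q))
            \<longleftrightarrow> \<not> (\<exists>F. F face_of P \<and> (int d - int \<gamma> + 1) simplex F))"
    (is "(?facets \<longleftrightarrow> ?join) \<and> (?join \<longleftrightarrow> \<not> ?face)")
proof -
  let ?V = "vertices P"
  note fin = polytope_vertices(1)[OF assms(2)] and PV = polytope_vertices(2)[OF assms(2)]
  have "?join" if facets: ?facets
  proof -
    interpret small_cofacets ?V
      by (rule small_cofacets_vertices[OF assms(2)]) (use facets in blast)
    obtain n jks where "\<forall>(j, k)\<in>set jks. 1 \<le> j \<and> 1 \<le> k" "simplex_sum_join n jks P"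
      using simplex_sum_join_convex_hull PV by auto
    then show ?join
      using combinatorially_equivalent_refl[of P] by blast
  qed
  moreover have ?facets if join: ?join
  proof (intro allI impI)
    fix F assume F: "F facet_of P"
    obtain n jks and Q :: "'a set" where Q: "\<forall>(j, k)\<in>set jks. 1 \<le> j \<and> 1 \<le> k"
      "simplex_sum_join n jks Q" "combinatorially_equivalent P Q"
      using join by blast
    obtain W where "has_small_cofaces W" "Q = convex hull W"
      using simplex_sum_join_has_small_cofaces[OF Q(2,1)] by blast
    then show "card (?V - vertices F) \<le> 2"
      using facets_of_combinatorially_equivalent[OF assms(2) _ _ F] Q(3) by blast
  qed
  moreover have "\<not> ?face" if facets: ?facets
  proof
    assume ?face
    then obtain F where F: "F face_of P" "(int d - int \<gamma> + 1) simplex F" by blast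
    interpret small_cofacets ?V
      by (rule small_cofacets_vertices[OF assms(2)]) (use facets in blast)
    obtain C where C: "\<not> affine_dependent C" "int (card C) = int d - int \<gamma> + 2" "F = convex hull C"
      using F(2) by (auto simp: simplex_def)
    have VF: "?V \<inter> F = C"
      using vertices_face[OF F(1)] vertices_simplex[OF C(1)] C(3) by simp
    obtain g where g: "affine_values ?V g" "\<And>x. x \<in> ?V \<Longrightarrow> 0 \<le> g x" "\<And>x. x \<in> ?V \<Longrightarrow> g x = 0 \<longleftrightarrow> x \<in> F"
      using face_affine_values[OF fin] F(1) PV by metis
    have "g x = 0 \<longleftrightarrow> x \<in> C" if "x \<in> ?V" for x
      using g(3)[OF that] that VF by blast
    then have "int (card ?V) + int (card C) \<le> 2 * (aff_dim ?V + 1)"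
      using VF by (intro card_simplex_face_le[OF _ C(1) g(1,2)]) auto
    moreover have "aff_dim ?V = int d"
      using assms(3) PV aff_dim_convex_hull by metis
    \<comment> \<open>The left side is
      \<open>(d + \<gamma> + 1) + (d - \<gamma> + 2) = 2 * d + 3\<close>, the right side
      \<open>2 * d + 2\<close>.\<close>
    ultimately show False using assms(4) C(2) by simp
  qed
  moreover have ?facets if "\<not> ?face"
  proof (intro allI impI, rule ccontr)
    fix F assume F: "F facet_of P" and "\<not> card (?V - vertices F) \<le> 2"
    then have card3: "3 \<le> card (?V - vertices F)" by simp
    have FP: "F face_of P" and dimF: "aff_dim F = int d - 1"
      using F assms(3) by (auto simp: facet_of_def)
    have sub: "vertices F \<subseteq> ?V" using vertices_face[OF FP] by blast
    have card: "card (vertices F) + card (?V - vertices F) = d + \<gamma> + 1"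
      using card_Diff_subset[OF finite_subset[OF sub fin] sub] card_mono[OF fin sub] assms(4) by simp
    obtain G e where G: "G face_of F" "e simplex G" "2 * aff_dim F + 1 - int (card (vertices F)) \<le> e"
      using simplex_face_exists[OF face_of_polytope_polytope[OF assms(2) FP]] by blast
    \<comment> \<open>The facet has dimension \<open>d - 1\<close> and at most
      \<open>d + \<gamma> - 2\<close> vertices, so the bound is
      \<open>2 * (d - 1) + 1 - (d + \<gamma> - 2) = d - \<gamma> + 1\<close>.\<close>
    have "int d - int \<gamma> + 1 \<le> e" using G(3) dimF card card3 by linarith
    moreover have "- 1 \<le> int d - int \<gamma> + 1" using assms(1) by simp
    ultimately obtain H where "H face_of G" "(int d - int \<gamma> + 1) simplex H"
      using simplex_face_lower_dim[OF G(2)] by blast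
    then show False
      using that face_of_trans[OF _ face_of_trans[OF G(1) FP]] by blast
  qed
  ultimately show ?thesis by blast
qed

end
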